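(* Let $N,\nu\in\{0,1,2,\dots\}$ and suppose that either $N$ is even and $\nu$ is odd, or $N$ is odd and $\nu$ is even. Then for all $z\in\mathbb{C}$ with $\Re(z)>0$, \[ F_\nu^N(z)=z^{-1}e^{-z}\sum_{s=0}^{M_{N,\nu}}\left[\sum_{j+r=s}a_j\,\Gamma(r+1/2)\sum_{k+l=r}b_{k,N}\, c_{l,j}\right] z^{-s}, \] where \[ M_{N,\nu}=\begin{cases} \nu-1 &\text{if } N<\nu, \\ N-1& \text{if } N>\nu, \end{cases} \] and \[ G_\nu^N(z)=z^{-2}e^{-z}\sum_{s=0}^{K_{N,\nu}}\left[\sum_{j+r=s}a_j\,\Gamma(r+3/2)\sum_{k+l=r}d_{k,N}\, c_{l,j}\right] z^{-s}, \] where $K_{N,\nu}=M_{N+2,\nu}-1$. Here the inner sums run over non-negative integers $j,r$ with $j+r=s$ and non-negative integers $k,l$ with $k+l=r$.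
   Context: For $\Re(z)>0$ and $\nu\in\mathbb{C}$, the modified Bessel function of the second kind is $K_\nu(z)=\int_0^\infty \exp(-z\cosh t)\cosh(\nu t)\,dt$. Define, for $\Re(z)>0$, \[ F_\nu^N(z)=\int_0^\infty \cosh^N(t)\, K_\nu(z\cosh t)\, dt,\qquad G_\nu^N(z)=\int_0^\infty \cosh^N(t)\, K_\nu(z\cosh t)\sinh^2(t)\, dt . \] The coefficients are: - $a_j=\sqrt{\dfrac{\pi}{2}}\;\dfrac{\prod_{l=1}^j\left(4\nu^2-(2l-1)^2\right)}{8^j\, j!}$ for $j\ge 0$ (they depend on $\nu$; the empty product is $1$); - $b_{j,N}=g_N^{(j)}(0)/j!$, the Taylor coefficients at $x=0$ of $g_N(x)=\dfrac{(x+1)^N}{\sqrt{x+2}}$; - $d_{j,N}=h_N^{(j)}(0)/j!$, the Taylor coefficients at $x=0$ of $h_N(x)=\sqrt{x+2}\,(x+1)^N$; - $c_{l,j}=\dfrac{(-1/2-j)(-1/2-j-1)\cdots(-1/2-j-(l-1))}{l!}$, the Taylor coefficients at $x=0$ of $(x+1)^{-1/2-j}=\sum_{l\ge0} c_{l,j}x^l$ (with $c_{0,j}=1$). *)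

theory Defs
  imports "HOL-Analysis.Analysis"
begin

definition bessel_K :: "complex \<Rightarrow> complex \<Rightarrow> complex" where
  "bessel_K \<nu> z =
     (LBINT t:{0..}. exp (- z * complex_of_real (cosh t)) * cosh (\<nu> * complex_of_real t))"

definition F_int :: "nat \<Rightarrow> complex \<Rightarrow> complex \<Rightarrow> complex" where
  "F_int N \<nu> z =
     (LBINT t:{0..}. complex_of_real (cosh t ^ N) * bessel_K \<nu> (z * complex_of_real (cosh t)))"

definition G_int :: "nat \<Rightarrow> complex \<Rightarrow> complex \<Rightarrow> complex" where
  "G_int N \<nu> z =
     (LBINT t:{0..}. complex_of_real (cosh t ^ N) * bessel_K \<nu> (z * complex_of_real (cosh t))
                       * complex_of_real ((sinh t)\<^sup>2))"

definition a_coeff :: "complex \<Rightarrow> nat \<Rightarrow> complex" where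
  "a_coeff \<nu> j =
     complex_of_real (sqrt (pi / 2)) *
       ((\<Prod>l=1..j. 4 * \<nu>\<^sup>2 - (2 * of_nat l - 1)\<^sup>2) / (8 ^ j * fact j))"

definition b_coeff :: "nat \<Rightarrow> nat \<Rightarrow> real" where
  "b_coeff j N = (deriv ^^ j) (\<lambda>x::real. (x + 1) ^ N / sqrt (x + 2)) 0 / fact j"

definition d_coeff :: "nat \<Rightarrow> nat \<Rightarrow> real" where
  "d_coeff j N = (deriv ^^ j) (\<lambda>x::real. sqrt (x + 2) * (x + 1) ^ N) 0 / fact j"

definition c_coeff :: "nat \<Rightarrow> nat \<Rightarrow> real" where
  "c_coeff l j = (- 1 / 2 - real j) gchoose l"

text \<open>
  The value at \<open>N = \<nu>\<close> is immaterial: the indices are only used for \<open>N\<close> and \<open>\<nu>\<close>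
  of opposite parity.  For such \<open>N\<close> and \<open>\<nu>\<close>, none of the subtractions on \<^typ>\<open>nat\<close>
  below truncates.
\<close>

definition M_index :: "nat \<Rightarrow> nat \<Rightarrow> nat" where
  "M_index N \<nu> = (if N < \<nu> then \<nu> - 1 else N - 1)"

definition K_index :: "nat \<Rightarrow> nat \<Rightarrow> nat" where
  "K_index N \<nu> = M_index (N + 2) \<nu> - 1"

end

theory Submission
  imports Defs "HOL-Probability.Sinc_Integral"
begin

text \<open>
  Two independent facts about \<^term>\<open>F_int\<close> combine. First, for \<open>N\<close> and \<open>\<nu>\<close> of opposite parity,
  \<open>z e\<^sup>z F(z)\<close> is exactly a polynomial in \<open>1/z\<close> of degree at most \<open>M\<close>. Secondly, for real
  \<open>z = x \<rightarrow> \<infinity>\<close> the function \<open>x e\<^sup>x F(x)\<close> has an asymptotic expansion in powers of \<open>1/x\<close> whose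
  coefficients are the bracketed sums. A polynomial in \<open>1/x\<close> is its own expansion, so the bracketed
  sums are the coefficients of the polynomial.

  For the closed form, extend both integrals to the whole line and substitute \<open>p = t + u\<close>,
  \<open>q = t - u\<close>. Since \<open>2 cosh t cosh u = cosh p + cosh q\<close>, the double integral of
  \<open>e\<^bsup>mt + \<nu>u\<^esup> exp(- z cosh t cosh u)\<close> factors into a product of two Bessel integrals of orders
  \<open>(m + \<nu>)/2\<close> and \<open>(m - \<nu>)/2\<close> at \<open>z/2\<close> (\<open>double_integral_bessel_int\<close>). Expanding \<open>cosh\<^sup>N t\<close> into
  exponentials leaves only \<open>m \<equiv> N\<close> modulo 2, and the parity hypothesis makes all the orders
  half-odd. There the three-term recurrence of Bessel functions reduces everything to order
  \<open>1/2\<close>, which is a Gaussian integral (\<open>bessel_int_half_odd\<close>, \<open>bessel_int_half_squared\<close>,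
  \<open>F_int_eq_poly\<close>).

  For the expansion, one version of Watson's lemma is used twice (\<open>watson_cosh\<close>): an integral of
  \<open>\<phi>(cosh t) exp(- x cosh t)\<close> is expanded by means of the Taylor coefficients at \<open>s = 0\<close> of
  \<open>\<phi>(1 + s) / sqrt (2 + s)\<close>. With \<open>\<phi>\<close> the Chebyshev polynomial \<open>T\<^sub>\<nu>\<close> it expands
  \<open>K\<^sub>\<nu>\<close> and produces the \<open>a\<^sub>j\<close>; with \<open>\<phi>(y) = y\<^bsup>N - j - 1/2\<^esup>\<close> it expands the outer integral and
  produces the convolutions of the \<open>b\<close> and \<open>c\<close> coefficients (\<open>F_real_asymptotics\<close>).

  The statement on \<^term>\<open>G_int\<close> follows from \<open>sinh\<^sup>2 = cosh\<^sup>2 - 1\<close>: on the side of the functions,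
  \<open>G\<^sup>N = F\<^bsup>N + 2\<^esup> - F\<^sup>N\<close>, and on the side of the coefficients \<open>g\<^bsub>N + 2\<^esub>(x) - g\<^sub>N(x) = x h\<^sub>N(x)\<close>, which
  cancels the leading term and shifts all the others by one.
\<close>

section \<open>Integrands dominated by powers of cosh times exp (- x cosh t)\<close>

lemma of_real_cosh: "complex_of_real (cosh t) = cosh (of_real t)"
  by (simp add: cosh_field_def flip: exp_of_real)

lemma of_real_sinh: "complex_of_real (sinh t) = sinh (of_real t)"
  by (simp add: sinh_field_def flip: exp_of_real)

lemma borel_measurable_cosh_sinh [measurable]:
  "(cosh :: real \<Rightarrow> real) \<in> borel_measurable borel"
  "(sinh :: real \<Rightarrow> real) \<in> borel_measurable borel"
  by (intro borel_measurable_continuous_onI continuous_intros)+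

lemma power_times_exp_le:
  fixes x y :: real
  assumes "x > 0" "y \<ge> 0"
  shows "y ^ n * exp (- x * y) \<le> fact n / x ^ n"
proof -
  have "(x * y) ^ n / fact n \<le> exp (x * y)"
  proof -
    have "(\<Sum>i\<in>{n}. inverse (fact i) * (x * y) ^ i) \<le> (\<Sum>i. inverse (fact i) * (x * y) ^ i)"
      using assms summable_exp[of "x * y"] by (intro sum_le_suminf) auto
    then show ?thesis by (simp add: exp_def divide_inverse mult.commute)
  qed
  then show ?thesis
    using assms by (simp add: field_simps exp_minus power_mult_distrib)
qed

lemma one_plus_square_le_cosh: "1 + t\<^sup>2 \<le> 4 * cosh (t::real)"
proof -
  have *: "1 + t\<^sup>2 \<le> 4 * cosh t" if "t \<ge> 0" for t :: real
    using exp_lower_Taylor_quadratic[OF that] exp_ge_add_one_self[of "- t"]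
    by (simp add: cosh_field_def)
  show ?thesis using *[of t] *[of "- t"] by (cases "t \<ge> 0") auto
qed

text \<open>
  The comparison function \<open>1 / (1 + t\<^sup>2)\<close> is integrable and tends to 0 at both ends. The bound comes from
  \<open>1 + t\<^sup>2 \<le> 4 cosh t\<close>, absorbed as one more power of \<open>cosh\<close>.
\<close>

lemma cosh_power_exp_le:
  fixes x t :: real
  assumes "x > 0"
  shows "cosh t ^ m * exp (- x * cosh t) \<le> 4 * fact (m + 1) / x ^ (m + 1) * inverse (1 + t\<^sup>2)"
proof -
  have "(1 + t\<^sup>2) * (cosh t ^ m * exp (- x * cosh t)) \<le> 4 * cosh t * (cosh t ^ m * exp (- x * cosh t))"
    by (intro mult_right_mono one_plus_square_le_cosh) auto
  also have "\<dots> = 4 * (cosh t ^ (m + 1) * exp (- x * cosh t))" by simp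
  also have "\<dots> \<le> 4 * (fact (m + 1) / x ^ (m + 1))"
    using power_times_exp_le[of x "cosh t" "m + 1"] assms by (intro mult_left_mono) auto
  finally show ?thesis
    using add_pos_nonneg[of 1 "t\<^sup>2"] unfolding divide_inverse[symmetric]
    by (subst pos_le_divide_eq) (auto simp: mult_ac)
qed

lemma integrable_inverse_one_plus_square: "integrable lborel (\<lambda>t::real. inverse (1 + t\<^sup>2))"
  using integrable_inverse_1_plus_square by (simp add: set_integrable_def)

lemma integral_inverse_one_plus_square: "(LBINT t::real. inverse (1 + t\<^sup>2)) = pi"
  using LBINT_inverse_1_plus_square
  by (simp add: interval_lebesgue_integral_def set_lebesgue_integral_def)

text \<open>
  A class of integrands closed under the operations needed below, so that integrability and the
  vanishing of boundary terms need no separate estimate for each integral. The rate \<open>x\<close> is kept fixed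
  while the power of \<open>cosh\<close> is free, because products and derivatives only change the latter.
\<close>

definition cosh_decaying :: "real \<Rightarrow> (real \<Rightarrow> 'a::real_normed_vector) \<Rightarrow> bool" where
  "cosh_decaying x f \<longleftrightarrow> (\<exists>C m. \<forall>t. norm (f t) \<le> C * (cosh t ^ m * exp (- x * cosh t)))"

lemma cosh_decayingI:
  assumes "\<And>t. norm (f t) \<le> C * (cosh t ^ m * exp (- x * cosh t))"
  shows "cosh_decaying x f"
  using assms unfolding cosh_decaying_def by blast

lemma cosh_decayingE:
  assumes "cosh_decaying x f"
  obtains C m where "C \<ge> 0" "\<And>t. norm (f t) \<le> C * (cosh t ^ m * exp (- x * cosh t))"
proof -
  from assms obtain C m where *: "\<And>t. norm (f t) \<le> C * (cosh t ^ m * exp (- x * cosh t))"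
    unfolding cosh_decaying_def by blast
  from order_trans[OF norm_ge_zero *[of 0]] have "C \<ge> 0" by (simp add: zero_le_mult_iff)
  then show ?thesis using * that by blast
qed

lemma cosh_decaying_bound:
  assumes "cosh_decaying x f" "x > 0"
  obtains C where "\<And>t. norm (f t) \<le> C * inverse (1 + t\<^sup>2)"
proof -
  obtain C m where C: "C \<ge> 0" "\<And>t. norm (f t) \<le> C * (cosh t ^ m * exp (- x * cosh t))"
    using cosh_decayingE[OF assms(1)] by blast
  show ?thesis
  proof (rule that)
    fix t
    show "norm (f t) \<le> (C * (4 * fact (m + 1) / x ^ (m + 1))) * inverse (1 + t\<^sup>2)"
      using order_trans[OF C(2) mult_left_mono[OF cosh_power_exp_le[OF assms(2)] C(1)]]
      by (simp add: mult.assoc)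
  qed
qed

lemma integrable_cosh_decaying:
  fixes f :: "real \<Rightarrow> 'a::{banach, second_countable_topology}"
  assumes "cosh_decaying x f" "x > 0" "f \<in> borel_measurable borel"
  shows "integrable lborel f"
proof -
  obtain C where "\<And>t. norm (f t) \<le> C * inverse (1 + t\<^sup>2)"
    using cosh_decaying_bound assms by blast
  then show ?thesis
    using assms(3)
    by (intro Bochner_Integration.integrable_bound[OF integrable_mult_right[OF integrable_inverse_one_plus_square, of C]])
       (auto intro!: order_trans[OF _ abs_ge_self])
qed

lemma cosh_decaying_tendsto_0:
  assumes "cosh_decaying x f" "x > 0"
  shows "(f \<longlongrightarrow> 0) at_top" "(f \<longlongrightarrow> 0) at_bot"
proof -
  obtain C where C: "\<And>t. norm (f t) \<le> C * inverse (1 + t\<^sup>2)"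
    using cosh_decaying_bound assms by blast
  have "((\<lambda>t::real. C * inverse (1 + t\<^sup>2)) \<longlongrightarrow> 0) at_top" "((\<lambda>t::real. C * inverse (1 + t\<^sup>2)) \<longlongrightarrow> 0) at_bot"
    by real_asymp+
  from Lim_null_comparison[OF always_eventually this(1)] Lim_null_comparison[OF always_eventually this(2)] C
  show "(f \<longlongrightarrow> 0) at_top" "(f \<longlongrightarrow> 0) at_bot" by blast+
qed

text \<open>
  Every integration by parts below is an instance: the integral of a derivative is the
  difference of the limits at both ends, and these are 0.
\<close>

lemma integral_derivative_cosh_decaying:
  fixes F f :: "real \<Rightarrow> 'a::euclidean_space"
  assumes x: "x > 0" and F: "cosh_decaying x F" and f: "cosh_decaying x f"
    and cont: "continuous_on UNIV f"
    and deriv: "\<And>t. (F has_vector_derivative f t) (at t)"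
  shows "(LBINT t. f t) = 0"
proof -
  have int: "integrable lborel f"
    using integrable_cosh_decaying[OF f x] cont by (simp add: borel_measurable_continuous_onI)
  have "(LBINT t=-\<infinity>..\<infinity>. f t) = 0 - 0"
    using cont deriv int cosh_decaying_tendsto_0[OF F x]
    by (intro interval_integral_FTC_integrable)
       (auto simp: set_integrable_def continuous_on_eq_continuous_at ereal_tendsto_simps)
  then show ?thesis
    by (simp add: interval_lebesgue_integral_def set_lebesgue_integral_def)
qed

lemma cosh_decaying_add:
  assumes "cosh_decaying x f" "cosh_decaying x g"
  shows "cosh_decaying x (\<lambda>t. f t + g t)"
proof -
  obtain C m where C: "C \<ge> 0" "\<And>t. norm (f t) \<le> C * (cosh t ^ m * exp (- x * cosh t))"
    using cosh_decayingE[OF assms(1)] by blast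
  obtain D n where D: "D \<ge> 0" "\<And>t. norm (g t) \<le> D * (cosh t ^ n * exp (- x * cosh t))"
    using cosh_decayingE[OF assms(2)] by blast
  show ?thesis
  proof (rule cosh_decayingI)
    fix t :: real
    have "norm (f t + g t) \<le> C * (cosh t ^ m * exp (- x * cosh t)) + D * (cosh t ^ n * exp (- x * cosh t))"
      using C(2)[of t] D(2)[of t] norm_triangle_ineq[of "f t" "g t"] by linarith
    also have "\<dots> \<le> C * (cosh t ^ (m + n) * exp (- x * cosh t)) + D * (cosh t ^ (m + n) * exp (- x * cosh t))"
      using C(1) D(1) cosh_real_ge_1[of t]
      by (intro add_mono mult_left_mono mult_right_mono power_increasing) auto
    finally show "norm (f t + g t) \<le> (C + D) * (cosh t ^ (m + n) * exp (- x * cosh t))"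
      by (simp add: algebra_simps)
  qed
qed

lemma cosh_decaying_times:
  fixes f g :: "real \<Rightarrow> 'a::real_normed_algebra"
  assumes "cosh_decaying x f" "\<And>t. norm (g t) \<le> D * cosh t ^ n"
  shows "cosh_decaying x (\<lambda>t. g t * f t)"
proof -
  obtain C m where C: "C \<ge> 0" "\<And>t. norm (f t) \<le> C * (cosh t ^ m * exp (- x * cosh t))"
    using cosh_decayingE[OF assms(1)] by blast
  show ?thesis
  proof (rule cosh_decayingI)
    fix t :: real
    have "norm (g t * f t) \<le> norm (g t) * norm (f t)" by (rule norm_mult_ineq)
    also have "\<dots> \<le> (D * cosh t ^ n) * (C * (cosh t ^ m * exp (- x * cosh t)))"
      using C assms(2)[of t] order_trans[OF norm_ge_zero assms(2)[of t]] by (intro mult_mono) auto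
    finally show "norm (g t * f t) \<le> (D * C) * (cosh t ^ (n + m) * exp (- x * cosh t))"
      by (simp add: power_add algebra_simps)
  qed
qed

text \<open>
  Exponentials are controlled by integer powers of \<open>cosh\<close>, which brings the integrands of Bessel
  integrals of arbitrary real order into the class above.
\<close>

lemma exp_le_cosh_power:
  assumes "\<bar>\<mu>\<bar> \<le> real n"
  shows "exp (\<mu> * t) \<le> (2 * cosh t) ^ n"
proof -
  have "exp (\<mu> * t) \<le> exp (real n * \<bar>t\<bar>)"
    using assms mult_mono[of "\<bar>\<mu>\<bar>" "real n" "\<bar>t\<bar>" "\<bar>t\<bar>"] abs_ge_self[of "\<mu> * t"]
    by (simp add: abs_mult)
  also have "\<dots> = exp \<bar>t\<bar> ^ n" by (simp add: exp_of_nat_mult)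
  also have "\<dots> \<le> (2 * cosh t) ^ n"
    by (intro power_mono) (auto simp: cosh_field_def abs_if)
  finally show ?thesis .
qed

lemma integral_half_line_even:
  fixes f :: "real \<Rightarrow> 'a::{banach, second_countable_topology}"
  assumes int: "integrable lborel f" and even: "\<And>t. f (- t) = f t"
  shows "(LBINT t:{0..}. f t) = (LBINT t. f t) /\<^sub>R 2"
proof -
  have i: "set_integrable lborel {0..} f" "set_integrable lborel {..<0} f"
    using int by (auto simp: set_integrable_def intro: integrable_mult_indicator)
  have "(LBINT t:{..<0}. f t) = (LBINT t. indicator {..<0} (0 + (-1) * t) *\<^sub>R f (0 + (-1) * t))"
    unfolding set_lebesgue_integral_def
    by (subst lborel_integral_real_affine[where c = "-1" and t = 0]) auto
  also have "\<dots> = (LBINT t:{0..}. f t)"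
    unfolding set_lebesgue_integral_def
    using AE_lborel_singleton[of "0::real"] int even
    by (intro integral_cong_AE) (auto simp: indicator_def elim!: eventually_mono)
  finally have "(LBINT t:{..<0}. f t) = (LBINT t:{0..}. f t)" .
  moreover have "(LBINT t:{..<0} \<union> {0..}. f t) = (LBINT t:{..<0}. f t) + (LBINT t:{0..}. f t)"
    using i by (intro set_integral_Un) auto
  moreover have "{..<0} \<union> {0..} = (UNIV :: real set)" by auto
  ultimately show ?thesis
    by (simp add: set_lebesgue_integral_def scaleR_2[symmetric])
qed

section \<open>Bessel integrals over the whole line\<close>

text \<open>
  This is \<open>2 K\<^sub>\<mu>(a)\<close>. On the whole line \<open>cosh (\<mu> t)\<close> can be replaced by the exponential \<open>exp (\<mu> t)\<close>,
  which is what lets the double integral factor after the change of variables.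
\<close>

definition bessel_int :: "real \<Rightarrow> complex \<Rightarrow> complex" where
  "bessel_int \<mu> a = (LBINT t. exp (of_real (\<mu> * t) - a * of_real (cosh t)))"

lemma cosh_decaying_exp:
  "cosh_decaying (Re a) (\<lambda>t. exp (complex_of_real (\<mu> * t) - a * of_real (cosh t)))"
proof -
  obtain n where n: "\<bar>\<mu>\<bar> \<le> real n" using real_arch_simple by blast
  show ?thesis
  proof (rule cosh_decayingI)
    fix t :: real
    have "norm (exp (complex_of_real (\<mu> * t) - a * of_real (cosh t))) = exp (\<mu> * t) * exp (- Re a * cosh t)"
      by (simp add: mult_exp_exp)
    also have "\<dots> \<le> (2 * cosh t) ^ n * exp (- Re a * cosh t)"
      using exp_le_cosh_power[OF n] by (intro mult_right_mono) auto
    finally show "norm (exp (complex_of_real (\<mu> * t) - a * of_real (cosh t)))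
        \<le> 2 ^ n * (cosh t ^ n * exp (- Re a * cosh t))"
      by (simp add: power_mult_distrib)
  qed
qed

lemma integrable_bessel_int:
  assumes "Re a > 0"
  shows "integrable lborel (\<lambda>t. exp (complex_of_real (\<mu> * t) - a * of_real (cosh t)))"
  by (rule integrable_cosh_decaying[OF cosh_decaying_exp assms]) measurable

lemma bessel_int_minus: "bessel_int (- \<mu>) a = bessel_int \<mu> a"
  unfolding bessel_int_def
  by (subst lborel_integral_real_affine[where c = "-1" and t = 0]) auto

text \<open>
  This is \<open>K\<^bsub>\<mu> + 1\<^esub> - K\<^bsub>\<mu> - 1\<^esub> = (2 \<mu> / a) K\<^sub>\<mu>\<close>, obtained by integrating the derivative of
  \<open>exp (\<mu> t - a cosh t)\<close>; multiplying by \<open>sinh t\<close> shifts the order by \<open>1\<close> up and down.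
\<close>

lemma bessel_int_recurrence:
  assumes a: "Re a > 0"
  shows "a * bessel_int (\<mu> + 1) a = a * bessel_int (\<mu> - 1) a + 2 * of_real \<mu> * bessel_int \<mu> a"
proof -
  let ?E = "\<lambda>\<mu> t. exp (complex_of_real (\<mu> * t) - a * of_real (cosh t))"
  let ?f = "\<lambda>t. of_real \<mu> * ?E \<mu> t + (- a / 2 * ?E (\<mu> + 1) t + a / 2 * ?E (\<mu> - 1) t)"
  have f: "?f t = (of_real \<mu> - a * of_real (sinh t)) * ?E \<mu> t" for t
  proof -
    have "?E (\<mu> + 1) t = ?E \<mu> t * of_real (exp t)" "?E (\<mu> - 1) t = ?E \<mu> t * of_real (exp (- t))"
      by (simp_all add: exp_add[symmetric] exp_of_real[symmetric] algebra_simps)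
    then show ?thesis by (simp add: sinh_field_def algebra_simps diff_divide_distrib)
  qed
  have dec: "cosh_decaying (Re a) (\<lambda>t. c * ?E \<mu> t)" for c \<mu>
    by (rule cosh_decaying_times[OF cosh_decaying_exp, of _ "norm c" 0]) simp
  have "(LBINT t. ?f t) = 0"
  proof (rule integral_derivative_cosh_decaying[OF a cosh_decaying_exp])
    show "cosh_decaying (Re a) ?f" by (intro cosh_decaying_add dec)
    show "continuous_on UNIV ?f" by (intro continuous_intros)
    show "(?E \<mu> has_vector_derivative ?f t) (at t)" for t
    proof -
      have "((\<lambda>w. exp (of_real \<mu> * w - a * cosh w)) has_field_derivative ?f t) (at (of_real t))"
        unfolding f by (auto intro!: derivative_eq_intros simp: of_real_cosh of_real_sinh)
      from has_vector_derivative_real_field[OF this]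
      show ?thesis by (simp add: o_def of_real_cosh)
    qed
  qed
  moreover have "(LBINT t. ?f t) = of_real \<mu> * bessel_int \<mu> a
      + (- a / 2 * bessel_int (\<mu> + 1) a + a / 2 * bessel_int (\<mu> - 1) a)"
    unfolding bessel_int_def
    by (subst Bochner_Integration.integral_add Bochner_Integration.integral_mult_right;
        (intro Bochner_Integration.integrable_add integrable_mult_right integrable_bessel_int a)?)+ simp
  ultimately show ?thesis by (simp add: field_simps)
qed

section \<open>The Gaussian integral and order one half\<close>

definition gauss_int :: "complex \<Rightarrow> complex" where
  "gauss_int z = (LBINT v. exp (- z * of_real (v\<^sup>2)))"

lemma integral_substitution_line:
  fixes f :: "real \<Rightarrow> 'a::euclidean_space"
  assumes "\<And>t. (g has_real_derivative g' t) (at t)"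
    and "continuous_on UNIV f" "continuous_on UNIV g'" "\<And>t. g' t \<ge> 0"
    and "filterlim g at_bot at_bot" "filterlim g at_top at_top"
    and "integrable lborel (\<lambda>t. g' t *\<^sub>R f (g t))" "integrable lborel f"
  shows "(LBINT v. f v) = (LBINT t. g' t *\<^sub>R f (g t))"
proof -
  have "(LBINT v=-\<infinity>..\<infinity>. f v) = (LBINT t=-\<infinity>..\<infinity>. g' t *\<^sub>R f (g t))"
    using assms
    by (intro interval_integral_substitution_integrable)
       (auto simp: set_integrable_def continuous_on_eq_continuous_at ereal_tendsto_simps)
  then show ?thesis
    by (simp add: interval_lebesgue_integral_def set_lebesgue_integral_def)
qed

lemma integrable_gauss:
  assumes z: "Re z > 0"
  shows "integrable lborel (\<lambda>v. of_real (\<bar>v\<bar> ^ n) * exp (- z * complex_of_real (v\<^sup>2)))"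
proof (rule Bochner_Integration.integrable_bound)
  let ?C = "exp (Re z) * (fact (n + 1) / Re z ^ (n + 1))"
  show "integrable lborel (\<lambda>v::real. ?C * inverse (1 + v\<^sup>2))"
    by (intro integrable_mult_right integrable_inverse_one_plus_square)
  show "AE v in lborel. norm (of_real (\<bar>v\<bar> ^ n) * exp (- z * complex_of_real (v\<^sup>2)))
          \<le> norm (?C * inverse (1 + v\<^sup>2))"
  proof (intro AE_I2)
    fix v :: real
    have pos: "1 + v\<^sup>2 > 0" by (simp add: add_pos_nonneg)
    have "\<bar>v\<bar> ^ n \<le> (1 + v\<^sup>2) ^ n"
      using sum_power2_ge_zero[of "\<bar>v\<bar> - 1/2" 0] by (intro power_mono) (auto simp: power2_eq_square algebra_simps)
    then have "(1 + v\<^sup>2) * (\<bar>v\<bar> ^ n * exp (- Re z * (1 + v\<^sup>2))) \<le> (1 + v\<^sup>2) ^ (n + 1) * exp (- Re z * (1 + v\<^sup>2))"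
      using pos by (simp add: mult.assoc mult_left_mono mult_right_mono)
    also have "\<dots> \<le> fact (n + 1) / Re z ^ (n + 1)"
      using power_times_exp_le[OF z, of "1 + v\<^sup>2" "n + 1"] pos by simp
    finally have *: "\<bar>v\<bar> ^ n * exp (- Re z * (1 + v\<^sup>2)) \<le> fact (n + 1) / Re z ^ (n + 1) * inverse (1 + v\<^sup>2)"
      using pos unfolding divide_inverse[symmetric] by (subst pos_le_divide_eq) (auto simp: mult_ac)
    have "norm (of_real (\<bar>v\<bar> ^ n) * exp (- z * complex_of_real (v\<^sup>2)))
        = exp (Re z) * (\<bar>v\<bar> ^ n * exp (- Re z * (1 + v\<^sup>2)))"
      by (simp add: norm_mult norm_power mult_exp_exp algebra_simps flip: mult.assoc)
    also have "\<dots> \<le> ?C * inverse (1 + v\<^sup>2)"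
      unfolding mult.assoc by (rule mult_left_mono[OF *]) simp
    finally show "norm (of_real (\<bar>v\<bar> ^ n) * exp (- z * complex_of_real (v\<^sup>2))) \<le> norm (?C * inverse (1 + v\<^sup>2))"
      unfolding real_norm_def by (rule order_trans[OF _ abs_ge_self])
  qed
qed measurable

lemma gauss_abs_moment:
  assumes z: "Re z > 0"
  shows "(LBINT x. of_real \<bar>x\<bar> * exp (- z * complex_of_real (x\<^sup>2))) = 1 / z"
proof -
  let ?f = "\<lambda>x. of_real \<bar>x\<bar> * exp (- z * complex_of_real (x\<^sup>2))"
  let ?F = "\<lambda>x. - exp (- z * complex_of_real (x\<^sup>2)) / (2 * z)"
  have z0: "z \<noteq> 0" using z by auto
  have int: "integrable lborel ?f" using integrable_gauss[OF z, of 1] by simp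
  have "((\<lambda>x::real. exp (- Re z * x\<^sup>2)) \<longlongrightarrow> 0) at_top"
    using z by real_asymp
  then have "((\<lambda>x. exp (- z * complex_of_real (x\<^sup>2))) \<longlongrightarrow> 0) at_top"
    by (intro tendsto_norm_zero_cancel[where f = "\<lambda>x. exp (- z * complex_of_real (x\<^sup>2))"]) simp
  from tendsto_divide[OF tendsto_minus[OF this] tendsto_const[of "2 * z"]]
  have lim: "(?F \<longlongrightarrow> 0) at_top" using z0 by simp
  have "(LBINT x=ereal 0..\<infinity>. ?f x) = 0 - (- 1 / (2 * z))"
  proof (rule interval_integral_FTC_integrable)
    show "(?F has_vector_derivative ?f x) (at x)" if "ereal 0 < ereal x" for x
    proof -
      have "((\<lambda>w. - exp (- z * w\<^sup>2) / (2 * z)) has_field_derivative ?f x) (at (of_real x))"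
        using z0 that by (auto intro!: derivative_eq_intros)
      from has_vector_derivative_real_field[OF this] show ?thesis by (simp add: o_def)
    qed
    show "isCont ?f x" for x by (intro continuous_intros)
    show "set_integrable lborel (einterval (ereal 0) \<infinity>) ?f"
      using int by (auto simp: set_integrable_def intro: integrable_mult_indicator)
    have "isCont ?F 0" using z0 by (intro continuous_intros) auto
    then have "(?F \<longlongrightarrow> - 1 / (2 * z)) (at_right 0)"
      by (auto simp: isCont_def intro: filterlim_mono[OF _ order_refl at_le])
    then show "((?F \<circ> real_of_ereal) \<longlongrightarrow> - 1 / (2 * z)) (at_right (ereal 0))"
      by (simp add: ereal_tendsto_simps)
    show "((?F \<circ> real_of_ereal) \<longlongrightarrow> 0) (at_left \<infinity>)"
      using lim by (simp add: ereal_tendsto_simps)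
  qed auto
  then have "(LBINT x:{0<..}. ?f x) = 1 / (2 * z)"
    by (simp add: interval_integral_to_infinity_eq)
  moreover have "(LBINT x:{0<..}. ?f x) = (LBINT x:{0..}. ?f x)"
    unfolding set_lebesgue_integral_def
    by (intro Bochner_Integration.integral_cong) (auto simp: indicator_def)
  moreover have "(LBINT x:{0..}. ?f x) = (LBINT x. ?f x) /\<^sub>R 2"
    using int by (intro integral_half_line_even) auto
  ultimately show ?thesis using z0 by (simp add: scaleR_conv_of_real field_simps)
qed

text \<open>
  For complex \<open>z\<close> rotational symmetry is replaced by the substitution \<open>y = x s\<close> in the inner integral of
  the square: \<open>- z (x\<^sup>2 + y\<^sup>2)\<close> becomes \<open>- z (1 + s\<^sup>2) x\<^sup>2\<close>, the integral over \<open>x\<close> is elementary, and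
  \<open>1 / (1 + s\<^sup>2)\<close> remains. Working with the square avoids the choice of a branch of \<open>sqrt z\<close>.
\<close>

lemma gauss_int_squared:
  assumes z: "Re z > 0"
  shows "(gauss_int z)\<^sup>2 = of_real pi / z"
proof -
  let ?w = "\<lambda>s::real. z * of_real (1 + s\<^sup>2)"
  let ?f = "\<lambda>s x. of_real \<bar>x\<bar> * exp (- ?w s * complex_of_real (x\<^sup>2))"
  have z0: "z \<noteq> 0" using z by auto
  have w: "Re (?w s) > 0" for s using z by (simp add: add_pos_nonneg)
  have norm_f: "(LBINT x. norm (?f s x)) = inverse (Re z) * inverse (1 + s\<^sup>2)" for s
  proof -
    have "complex_of_real (LBINT x. norm (?f s x)) = (LBINT x. complex_of_real (norm (?f s x)))"
      by simp
    also have "\<dots> = (LBINT x. of_real \<bar>x\<bar> * exp (- of_real (Re (?w s)) * complex_of_real (x\<^sup>2)))"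
      by (intro Bochner_Integration.integral_cong) (auto simp: norm_mult exp_of_real[symmetric])
    also have "\<dots> = complex_of_real (inverse (Re (?w s)))"
      using w[of s] by (subst gauss_abs_moment) (auto simp: field_simps)
    finally show ?thesis unfolding of_real_eq_iff by (simp add: field_simps)
  qed
  have "integrable (lborel \<Otimes>\<^sub>M lborel) (case_prod ?f)"
  proof (rule lborel_pair.Fubini_integrable)
    show "integrable lborel (\<lambda>s. LBINT x. norm (case_prod ?f (s, x)))"
      by (simp only: prod.case norm_f) (intro integrable_mult_right integrable_inverse_one_plus_square)
    show "AE s in lborel. integrable lborel (\<lambda>x. case_prod ?f (s, x))"
      using integrable_gauss[OF w, of 1] by simp
  qed measurable
  from lborel_pair.Fubini_integral[OF this]
  have "(LBINT x. LBINT s. ?f s x) = (LBINT s. LBINT x. ?f s x)" .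
  also have "\<dots> = (LBINT s. (1 / z) * of_real (inverse (1 + s\<^sup>2)))"
    using gauss_abs_moment[OF w] by (simp add: divide_inverse)
  also have "\<dots> = of_real pi / z"
    using integral_inverse_one_plus_square
    by (simp only: integral_mult_right_zero integral_complex_of_real) simp
  also have "(LBINT x. LBINT s. ?f s x) = (LBINT x. exp (- z * of_real (x\<^sup>2)) * gauss_int z)"
  proof (rule integral_cong_AE)
    have "(LBINT s. ?f s x) = exp (- z * of_real (x\<^sup>2)) * gauss_int z" if "x \<noteq> 0" for x
    proof -
      have "gauss_int z = (LBINT s. of_real \<bar>x\<bar> * exp (- z * of_real ((x * s)\<^sup>2)))"
        unfolding gauss_int_def using that
        by (subst lborel_integral_real_affine[of x _ 0]) (simp_all add: scaleR_conv_of_real)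
      then show ?thesis
        by (simp add: integral_mult_right_zero[symmetric] mult_exp_exp algebra_simps power_mult_distrib
            del: integral_mult_right_zero integral_mult_right)
    qed
    then show "AE x in lborel. (LBINT s. ?f s x) = exp (- z * of_real (x\<^sup>2)) * gauss_int z"
      using AE_lborel_singleton[of "0::real"] by (auto elim!: eventually_mono)
  qed measurable
  also have "\<dots> = (gauss_int z)\<^sup>2"
    by (simp add: gauss_int_def power2_eq_square)
  finally show ?thesis by simp
qed

text \<open>
  The substitution \<open>v = sinh (t / 2)\<close> turns \<open>cosh t\<close> into \<open>1 + 2 v\<^sup>2\<close>. Its derivative
  \<open>cosh (t / 2) / 2\<close> is, up to a constant, the even part of \<open>exp (t / 2)\<close>.
\<close>

lemma bessel_int_half:
  assumes a: "Re a > 0"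
  shows "bessel_int (1/2) a = 2 * exp (- a) * gauss_int (2 * a)"
proof -
  let ?E = "\<lambda>\<mu> t. exp (complex_of_real (\<mu> * t) - a * of_real (cosh t))"
  have ch: "cosh t = 1 + 2 * (sinh (t / 2))\<^sup>2" for t :: real
    using cosh_double[of "t / 2"] by (simp add: cosh_square_eq)
  have E: "?E (1/2) t + ?E (-1/2) t
      = 4 * exp (- a) * ((cosh (t / 2) / 2) *\<^sub>R exp (- (2 * a) * complex_of_real ((sinh (t / 2))\<^sup>2)))" for t
  proof -
    have split: "?E \<mu> t = exp (- a * of_real (cosh t)) * exp (of_real (\<mu> * t))" for \<mu>
      by (simp add: mult_exp_exp)
    have "?E (1/2) t + ?E (-1/2) t = exp (- a * of_real (cosh t)) * (2 * of_real (cosh (t / 2)))"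
      unfolding split by (simp add: cosh_field_def[of "t / 2"] distrib_left flip: exp_of_real)
    also have "exp (- a * of_real (cosh t)) = exp (- a) * exp (- (2 * a) * complex_of_real ((sinh (t / 2))\<^sup>2))"
      by (subst ch) (simp add: mult_exp_exp algebra_simps)
    finally show ?thesis by (simp add: scaleR_conv_of_real)
  qed
  have iE: "integrable lborel (?E \<mu>)" for \<mu> by (rule integrable_bessel_int[OF a])
  have "2 * bessel_int (1/2) a = bessel_int (1/2) a + bessel_int (-1/2) a"
    using bessel_int_minus[of "1/2" a] by simp
  also have "\<dots> = (LBINT t. ?E (1/2) t + ?E (-1/2) t)"
    unfolding bessel_int_def by (intro Bochner_Integration.integral_add[symmetric] iE)
  also have "\<dots> = 4 * exp (- a) * (LBINT t. (cosh (t / 2) / 2) *\<^sub>R exp (- (2 * a) * complex_of_real ((sinh (t / 2))\<^sup>2)))"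
    unfolding E by (simp only: integral_mult_right_zero)
  also have "(LBINT t. (cosh (t / 2) / 2) *\<^sub>R exp (- (2 * a) * complex_of_real ((sinh (t / 2))\<^sup>2))) = gauss_int (2 * a)"
    unfolding gauss_int_def
  proof (rule integral_substitution_line[symmetric])
    show "((\<lambda>t. sinh (t / 2)) has_real_derivative cosh (t / 2) / 2) (at t)" for t
      by (auto intro!: derivative_eq_intros)
    show "filterlim (\<lambda>t::real. sinh (t / 2)) at_top at_top"
      by (rule filterlim_compose[OF sinh_real_at_top]) real_asymp
    show "filterlim (\<lambda>t::real. sinh (t / 2)) at_bot at_bot"
      by (rule filterlim_compose[OF sinh_real_at_bot]) real_asymp
    show "integrable lborel (\<lambda>v. exp (- (2 * a) * complex_of_real (v\<^sup>2)))"
      using integrable_gauss[of "2 * a" 0] a by simp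
    have "integrable lborel (\<lambda>t. 1 / (4 * exp (- a)) * (?E (1/2) t + ?E (-1/2) t))"
      by (intro integrable_mult_right Bochner_Integration.integrable_add iE)
    then show "integrable lborel (\<lambda>t. (cosh (t / 2) / 2) *\<^sub>R exp (- (2 * a) * complex_of_real ((sinh (t / 2))\<^sup>2)))"
      unfolding E by simp
  qed (auto intro!: continuous_intros)
  finally show ?thesis by simp
qed

lemma bessel_int_half_squared:
  assumes a: "Re a > 0"
  shows "(bessel_int (1/2) a)\<^sup>2 = 2 * of_real pi * exp (- 2 * a) / a"
  using bessel_int_half[OF a] gauss_int_squared[of "2 * a"] a
  by (simp add: power_mult_distrib exp_double[symmetric] field_simps)

section \<open>The closed form\<close>

text \<open>
  Both hyperbolic cosines are at least 1, so \<open>2 cosh t cosh u \<ge> cosh t + cosh u\<close>. This separates the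
  variables, and the Bessel integral inherits a decay in \<open>cosh t\<close> at half the rate.
\<close>

lemma bessel_int_bound:
  assumes z: "Re z > 0"
  shows "norm (bessel_int \<mu> (z * of_real (cosh t)))
          \<le> (LBINT u. exp (\<mu> * u - Re z / 2 * cosh u)) * exp (- (Re z / 2) * cosh t)"
proof -
  have int: "integrable lborel (\<lambda>u. exp (\<mu> * u - Re z / 2 * cosh u))"
    using integrable_norm[OF integrable_bessel_int[of "of_real (Re z / 2)" \<mu>]] z by simp
  have zt: "Re (z * of_real (cosh t)) > 0" using z by simp
  have "norm (bessel_int \<mu> (z * of_real (cosh t)))
      \<le> (LBINT u. norm (exp (complex_of_real (\<mu> * u) - z * of_real (cosh t) * of_real (cosh u))))"
    unfolding bessel_int_def by (rule integral_norm_bound)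
  also have "\<dots> \<le> (LBINT u. exp (\<mu> * u - Re z / 2 * cosh u) * exp (- (Re z / 2) * cosh t))"
  proof (rule integral_mono)
    fix u :: real
    have "0 \<le> (cosh t - 1) * cosh u + cosh t * (cosh u - 1)"
      by (intro add_nonneg_nonneg mult_nonneg_nonneg) (auto simp: cosh_real_ge_1)
    then have "Re z / 2 * (cosh t + cosh u) \<le> Re z / 2 * (2 * (cosh t * cosh u))"
      using z by (intro mult_left_mono) (auto simp: algebra_simps)
    then show "norm (exp (complex_of_real (\<mu> * u) - z * of_real (cosh t) * of_real (cosh u)))
        \<le> exp (\<mu> * u - Re z / 2 * cosh u) * exp (- (Re z / 2) * cosh t)"
      by (simp add: mult_exp_exp algebra_simps)
  qed (use integrable_norm[OF integrable_bessel_int[OF zt]] int in auto)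
  finally show ?thesis by simp
qed

lemma cosh_decaying_bessel_int:
  assumes z: "Re z > 0"
  shows "cosh_decaying (Re z / 2) (\<lambda>t. bessel_int \<mu> (z * of_real (cosh t)))"
  using bessel_int_bound[OF z]
  by (intro cosh_decayingI[where m = 0 and C = "LBINT u. exp (\<mu> * u - Re z / 2 * cosh u)"]) simp

lemma borel_measurable_bessel_int [measurable]:
  "(\<lambda>t. bessel_int \<mu> (z * of_real (cosh t))) \<in> borel_measurable borel"
  unfolding bessel_int_def by measurable

lemma integrable_times_bessel_int:
  assumes z: "Re z > 0" and g [measurable]: "g \<in> borel_measurable borel"
    and bound: "\<And>t. norm (g t) \<le> D * cosh t ^ n"
  shows "integrable lborel (\<lambda>t. g t * bessel_int \<mu> (z * of_real (cosh t)))"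
  by (rule integrable_cosh_decaying[OF cosh_decaying_times[OF cosh_decaying_bessel_int[OF z] bound]])
     (use z in \<open>auto intro: measurable\<close>)

lemma bessel_K_eq_bessel_int:
  assumes z: "Re z > 0"
  shows "bessel_K (of_nat \<nu>) z = bessel_int (real \<nu>) z / 2"
proof -
  let ?E = "\<lambda>\<mu> t. exp (complex_of_real (\<mu> * t) - z * of_real (cosh t))"
  have eq: "exp (- z * complex_of_real (cosh t)) * cosh (of_nat \<nu> * complex_of_real t)
      = (?E (real \<nu>) t + ?E (- real \<nu>) t) / 2" for t
  proof -
    have split: "?E \<mu> t = exp (- z * of_real (cosh t)) * exp (of_real (\<mu> * t))" for \<mu>
      by (simp add: mult_exp_exp)
    show ?thesis unfolding split by (simp add: cosh_field_def distrib_left)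
  qed
  have iE: "integrable lborel (?E \<mu>)" for \<mu> by (rule integrable_bessel_int[OF z])
  have "bessel_K (of_nat \<nu>) z = (LBINT t. (?E (real \<nu>) t + ?E (- real \<nu>) t) / 2) /\<^sub>R 2"
    unfolding bessel_K_def eq
    by (intro integral_half_line_even integrable_divide_zero impI Bochner_Integration.integrable_add iE)
       (simp add: add.commute)
  also have "(LBINT t. (?E (real \<nu>) t + ?E (- real \<nu>) t) / 2)
      = (bessel_int (real \<nu>) z + bessel_int (- real \<nu>) z) / 2"
    using iE[of "real \<nu>"] iE[of "- real \<nu>"] by (simp add: bessel_int_def)
  finally show ?thesis by (simp add: bessel_int_minus scaleR_conv_of_real)
qed

lemma F_int_eq_bessel_int:
  assumes z: "Re z > 0"
  shows "F_int N (of_nat \<nu>) z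
          = (LBINT t. of_real (cosh t ^ N) * bessel_int (real \<nu>) (z * of_real (cosh t))) / 4"
proof -
  have int: "integrable lborel (\<lambda>t. of_real (cosh t ^ N) * bessel_int (real \<nu>) (z * of_real (cosh t)))"
    by (rule integrable_times_bessel_int[OF z, of _ 1 N]) (auto simp: norm_power)
  have "F_int N (of_nat \<nu>) z
      = (LBINT t:{0..}. of_real (cosh t ^ N) * bessel_int (real \<nu>) (z * of_real (cosh t)) / 2)"
    unfolding F_int_def using z by (subst bessel_K_eq_bessel_int) auto
  also have "\<dots> = (LBINT t. of_real (cosh t ^ N) * bessel_int (real \<nu>) (z * of_real (cosh t)) / 2) /\<^sub>R 2"
    using int by (intro integral_half_line_even) auto
  finally show ?thesis by (simp add: scaleR_conv_of_real)
qed

lemma G_int_eq_F_int: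
  assumes z: "Re z > 0"
  shows "G_int N (of_nat \<nu>) z = F_int (N + 2) (of_nat \<nu>) z - F_int N (of_nat \<nu>) z"
proof -
  have int: "integrable lborel (\<lambda>t. of_real (cosh t ^ N) * bessel_int (real \<nu>) (z * of_real (cosh t)))" for N
    by (rule integrable_times_bessel_int[OF z, of _ 1 N]) (auto simp: norm_power)
  have sint: "set_integrable lborel {0..}
      (\<lambda>t. of_real (cosh t ^ N) * bessel_K (of_nat \<nu>) (z * of_real (cosh t)))" for N
    using integrable_mult_indicator[OF _ integrable_divide_zero[of 2, OF int[of N]], of "{0..}"] z
    unfolding set_integrable_def by (subst bessel_K_eq_bessel_int) auto
  show ?thesis
    unfolding F_int_def G_int_def
    by (subst set_integral_diff(2)[OF sint sint, symmetric])
       (simp add: sinh_square_eq algebra_simps, simp add: power2_eq_square mult_ac)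
qed

text \<open>
  The linear change of variables \<open>p = t + u\<close>, \<open>q = t - u\<close> is carried out one variable at a time:
  \<open>u = p - t\<close> in the inner integral, then Fubini, then \<open>t = (p + q) / 2\<close>, whose derivative is the factor
  \<open>1/2\<close>. Fubini is justified because the absolute value of the integrand factors in the same way.
\<close>

lemma double_integral_bessel_int:
  assumes z: "Re z > 0"
  shows "(LBINT t. exp (of_real (m * t)) * bessel_int n (z * of_real (cosh t)))
          = bessel_int ((m + n) / 2) (z / 2) * bessel_int ((m - n) / 2) (z / 2) / 2"
proof -
  define f where "f = (\<lambda>t u. exp (complex_of_real (m * t + n * u) - z * of_real (cosh t) * of_real (cosh u)))"
  define h where "h = (\<lambda>p t. f t (p - t))"
  define A where "A = (\<lambda>p. exp (complex_of_real ((m + n) / 2 * p) - z / 2 * of_real (cosh p)))"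
  define B where "B = (\<lambda>q. exp (complex_of_real ((m - n) / 2 * q) - z / 2 * of_real (cosh q)))"
  have z2: "Re (z / 2) > 0" using z by simp
  have intA: "integrable lborel A" and intB: "integrable lborel B"
    unfolding A_def B_def by (rule integrable_bessel_int[OF z2])+
  have prod: "h p (p / 2 + 1 / 2 * q) = A p * B q" for p q
  proof -
    let ?t = "p / 2 + q / 2" and ?u = "p / 2 - q / 2"
    have "cosh (?t + ?u) + cosh (?t - ?u) = 2 * (cosh ?t * cosh ?u)"
      unfolding cosh_add cosh_diff by simp
    moreover have "?t + ?u = p" "?t - ?u = q" by simp_all
    ultimately have c: "cosh ?t * cosh ?u = (cosh p + cosh q) / 2" by (metis nonzero_mult_div_cancel_left zero_neq_numeral)
    have "h p (p / 2 + 1 / 2 * q) = exp (complex_of_real (m * ?t + n * ?u) - z * of_real (cosh ?t * cosh ?u))"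
      by (simp add: h_def f_def field_simps)
    also have "\<dots> = A p * B q"
      unfolding c A_def B_def mult_exp_exp
      by (rule arg_cong[where f = exp]) (simp add: field_simps)
    finally show ?thesis .
  qed
  have inner: "integrable lborel (h p)" "(LBINT t. h p t) = A p * (LBINT q. B q) / 2"
    "(LBINT t. norm (h p t)) = norm (A p) * (LBINT q. norm (B q)) / 2" for p
  proof -
    show "integrable lborel (h p)"
      using lborel_integrable_real_affine_iff[of "1/2" "h p" "p / 2"] intB unfolding prod by simp
    show "(LBINT t. h p t) = A p * (LBINT q. B q) / 2"
      using lborel_integral_real_affine[of "1/2" "h p" "p / 2"] unfolding prod by (simp add: scaleR_conv_of_real)
    show "(LBINT t. norm (h p t)) = norm (A p) * (LBINT q. norm (B q)) / 2"
      using lborel_integral_real_affine[of "1/2" "\<lambda>t. norm (h p t)" "p / 2"]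
      unfolding prod by (simp add: norm_mult)
  qed
  have "integrable (lborel \<Otimes>\<^sub>M lborel) (case_prod h)"
  proof (rule lborel_pair.Fubini_integrable)
    show "case_prod h \<in> borel_measurable (lborel \<Otimes>\<^sub>M lborel)"
      unfolding h_def f_def by measurable
    show "integrable lborel (\<lambda>p. LBINT t. norm (case_prod h (p, t)))"
      using intA by (simp add: inner)
    show "AE p in lborel. integrable lborel (\<lambda>t. case_prod h (p, t))"
      using inner(1) by simp
  qed
  from lborel_pair.Fubini_integral[OF this]
  have "(LBINT t. LBINT p. h p t) = (LBINT p. LBINT t. h p t)" .
  also have "\<dots> = (LBINT p. A p) * (LBINT q. B q) / 2"
    by (simp add: inner)
  also have "(LBINT t. LBINT p. h p t) = (LBINT t. LBINT u. f t u)"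
  proof (rule Bochner_Integration.integral_cong[OF refl])
    fix t
    show "(LBINT p. h p t) = (LBINT u. f t u)"
      using lborel_integral_real_affine[of 1 "f t" "- t"] by (simp add: h_def)
  qed
  also have "\<dots> = (LBINT t. exp (of_real (m * t)) * bessel_int n (z * of_real (cosh t)))"
  proof -
    have "f t u = exp (of_real (m * t)) * exp (of_real (n * u) - z * of_real (cosh t) * of_real (cosh u))" for t u
      by (simp add: f_def mult_exp_exp algebra_simps)
    then show ?thesis by (simp add: bessel_int_def)
  qed
  finally show ?thesis by (simp add: A_def B_def bessel_int_def)
qed

text \<open>
  The Bessel polynomials with the argument doubled, \<open>y\<^sub>n(2 w)\<close> at \<open>w = 1 / (2 a)\<close>: their recurrence is that of
  \<open>bessel_int\<close> at half-odd orders, divided by the value at order \<open>1/2\<close>. The doubling makes the final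
  formula, where \<open>a = z / 2\<close>, a polynomial in \<open>1 / z\<close>.
\<close>

fun half_bessel_poly :: "nat \<Rightarrow> complex poly" where
  "half_bessel_poly 0 = 1"
| "half_bessel_poly (Suc 0) = [:1, 2:]"
| "half_bessel_poly (Suc (Suc n)) = half_bessel_poly n + pCons 0 (smult (of_nat (4 * n + 6)) (half_bessel_poly (Suc n)))"

lemma degree_half_bessel_poly: "degree (half_bessel_poly n) \<le> n"
proof (induction n rule: half_bessel_poly.induct)
  case (3 n)
  then show ?case
    by (auto intro!: degree_add_le degree_pCons_le[THEN order_trans] degree_smult_le[THEN order_trans])
qed auto

lemma bessel_int_half_odd:
  assumes a: "Re a > 0"
  shows "bessel_int (real n + 1/2) a = bessel_int (1/2) a * poly (half_bessel_poly n) (1 / (2 * a))"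
proof (induction n rule: half_bessel_poly.induct)
  case 2
  have "a \<noteq> 0" using a by auto
  then show ?case using bessel_int_recurrence[OF a, of "1/2"] bessel_int_minus[of "1/2" a]
    by (auto simp: field_simps)
next
  case (3 n)
  have a0: "a \<noteq> 0" using a by auto
  have "real (Suc (Suc n)) + 1/2 = (real n + 3/2) + 1" "real n + 3/2 - 1 = real n + 1/2"
     "real (Suc n) + 1 / 2 = real n + 3 / 2" by simp_all
  then show ?case using bessel_int_recurrence[OF a, of "real n + 3/2"] 3 a0
    by (auto simp: field_simps)
qed auto

lemma bessel_int_half_odd_int:
  assumes a: "Re a > 0" and k: "odd k"
  shows "bessel_int (real_of_int k / 2) a
     = bessel_int (1/2) a * poly (half_bessel_poly (nat ((\<bar>k\<bar> - 1) div 2))) (1 / (2 * a))"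
proof -
  have "bessel_int (real_of_int k / 2) a = bessel_int (real_of_int \<bar>k\<bar> / 2) a"
    using bessel_int_minus[of "real_of_int k / 2" a] by (auto simp: abs_if)
  also have "real_of_int \<bar>k\<bar> / 2 = real (nat ((\<bar>k\<bar> - 1) div 2)) + 1 / 2"
  proof -
    have "\<bar>k\<bar> = 2 * ((\<bar>k\<bar> - 1) div 2) + 1" "(\<bar>k\<bar> - 1) div 2 \<ge> 0" using k by presburger+
    then have "real_of_int \<bar>k\<bar> = real_of_int (2 * int (nat ((\<bar>k\<bar> - 1) div 2)) + 1)" by simp
    then show ?thesis by simp
  qed
  finally show ?thesis using bessel_int_half_odd[OF a] by simp
qed

text \<open>
  The binomial expansion of \<open>cosh\<^sup>N t\<close> contributes the frequencies \<open>m = 2 k - N\<close>, and a Bessel integral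
  of order \<open>n / 2\<close> with \<open>n\<close> odd is the one of order \<open>1/2\<close> times the polynomial of index
  \<open>(\<bar>n\<bar> - 1) / 2\<close>, here for \<open>n = m + \<nu>\<close> and
  \<open>n = m - \<nu>\<close>. The constant collects \<open>1/4\<close> from the two half-lines, \<open>2\<^bsup>-N\<^esup>\<close> from the expansion, \<open>1/2\<close> from
  the change of variables, and \<open>4 \<pi>\<close> from the square of the integral of order \<open>1/2\<close>.
\<close>

definition F_poly :: "nat \<Rightarrow> nat \<Rightarrow> complex poly" where
  "F_poly N \<nu> = smult (of_real pi / 2 ^ (N + 1)) (\<Sum>k\<le>N. smult (of_nat (N choose k))
     (half_bessel_poly (nat ((\<bar>2 * int k - int N + int \<nu>\<bar> - 1) div 2)) *
      half_bessel_poly (nat ((\<bar>2 * int k - int N - int \<nu>\<bar> - 1) div 2))))"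

text \<open>
  The two indices add up to \<open>(\<bar>m + \<nu>\<bar> + \<bar>m - \<nu>\<bar>) / 2 - 1 = max \<bar>m\<bar> \<nu> - 1\<close>, and \<open>\<bar>m\<bar> \<le> N\<close>.
\<close>

lemma degree_F_poly:
  assumes "odd (N + \<nu>)"
  shows "degree (F_poly N \<nu>) \<le> M_index N \<nu>"
  unfolding F_poly_def
proof (rule order_trans[OF degree_smult_le], rule degree_sum_le, simp,
       rule order_trans[OF degree_smult_le], rule order_trans[OF degree_mult_le])
  fix k assume k: "k \<in> {..N}"
  let ?m = "2 * int k - int N"
  have "nat ((\<bar>?m + int \<nu>\<bar> - 1) div 2) + nat ((\<bar>?m - int \<nu>\<bar> - 1) div 2) \<le> M_index N \<nu>"
  proof -
    define m where "m = ?m"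
    have "odd (?m + int \<nu>)" "odd (?m - int \<nu>)" using assms by simp_all
    moreover have "\<bar>?m\<bar> \<le> int N" using k by auto
    ultimately have "odd (m + int \<nu>)" "odd (m - int \<nu>)" "\<bar>m\<bar> \<le> int N" by (simp_all add: m_def)
    moreover have "N < \<nu> \<or> \<nu> < N" using assms by (cases N \<nu> rule: linorder_cases) auto
    ultimately show ?thesis unfolding M_index_def m_def[symmetric] by (auto simp: abs_if elim!: oddE)
  qed
  then show "degree (half_bessel_poly (nat ((\<bar>?m + int \<nu>\<bar> - 1) div 2)))
      + degree (half_bessel_poly (nat ((\<bar>?m - int \<nu>\<bar> - 1) div 2))) \<le> M_index N \<nu>"
    using degree_half_bessel_poly order_trans add_mono by meson
qed

lemma F_int_eq_poly:
  assumes parity: "odd (N + \<nu>)" and z: "Re z > 0"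
  shows "F_int N (of_nat \<nu>) z = exp (- z) / z * poly (F_poly N \<nu>) (1 / z)"
proof -
  let ?L = "\<lambda>t. bessel_int (real \<nu>) (z * of_real (cosh t))"
  let ?hp = "\<lambda>k. half_bessel_poly (nat ((\<bar>k\<bar> - 1) div 2))"
  have z2: "Re (z / 2) > 0" and z0: "z \<noteq> 0" using z by auto
  have expand: "complex_of_real (cosh t ^ N)
      = (\<Sum>k\<le>N. of_nat (N choose k) / 2 ^ N * exp (of_real ((2 * real k - real N) * t)))" for t
  proof -
    have "cosh t ^ N = (exp t + exp (- t)) ^ N / 2 ^ N" by (simp add: cosh_field_def power_divide)
    also have "(exp t + exp (- t)) ^ N = (\<Sum>k\<le>N. real (N choose k) * exp t ^ k * exp (- t) ^ (N - k))"
      by (rule binomial_ring)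
    also have "\<dots> = (\<Sum>k\<le>N. real (N choose k) * exp ((2 * real k - real N) * t))"
      by (intro sum.cong refl)
         (simp add: mult.assoc mult_exp_exp of_nat_diff algebra_simps flip: exp_of_nat_mult)
    finally have *: "cosh t ^ N = (\<Sum>k\<le>N. real (N choose k) / 2 ^ N * exp ((2 * real k - real N) * t))"
      by (simp add: sum_divide_distrib)
    show ?thesis unfolding * by (simp add: exp_of_real[symmetric])
  qed
  have int: "integrable lborel (\<lambda>t. exp (of_real ((2 * real k - real N) * t)) * ?L t)" for k
  proof -
    obtain n where n: "\<bar>2 * real k - real N\<bar> \<le> real n" using real_arch_simple by blast
    show ?thesis
      by (rule integrable_times_bessel_int[OF z, of _ "2 ^ n" n])
         (use exp_le_cosh_power[OF n] in \<open>auto simp: power_mult_distrib\<close>)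
  qed
  have summand: "(LBINT t. exp (of_real ((2 * real k - real N) * t)) * ?L t)
      = 4 * of_real pi * exp (- z) / z / 2 * poly (?hp (2 * int k - int N + int \<nu>) * ?hp (2 * int k - int N - int \<nu>)) (1 / z)" for k
  proof -
    have odds: "odd (2 * int k - int N + int \<nu>)" "odd (2 * int k - int N - int \<nu>)"
      using parity by auto
    have "(bessel_int (1/2) (z/2))\<^sup>2 = 4 * of_real pi * exp (- z) / z"
      using bessel_int_half_squared[OF z2] by simp
    moreover have "(LBINT t. exp (of_real ((2 * real k - real N) * t)) * ?L t)
        = (bessel_int (1/2) (z/2))\<^sup>2 / 2 * poly (?hp (2 * int k - int N + int \<nu>) * ?hp (2 * int k - int N - int \<nu>)) (1 / z)"
      using double_integral_bessel_int[OF z, of "2 * real k - real N" "real \<nu>"]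
        bessel_int_half_odd_int[OF z2 odds(1)] bessel_int_half_odd_int[OF z2 odds(2)]
      by (simp add: power2_eq_square mult_ac)
    ultimately show ?thesis by simp
  qed
  have "(LBINT t. of_real (cosh t ^ N) * ?L t)
      = (LBINT t. \<Sum>k\<le>N. of_nat (N choose k) / 2 ^ N * (exp (of_real ((2 * real k - real N) * t)) * ?L t))"
    unfolding expand sum_distrib_right mult.assoc ..
  also have "\<dots> = (\<Sum>k\<le>N. of_nat (N choose k) / 2 ^ N * (LBINT t. exp (of_real ((2 * real k - real N) * t)) * ?L t))"
    using int by (subst Bochner_Integration.integral_sum) auto
  finally show ?thesis
    unfolding F_int_eq_bessel_int[OF z] summand F_poly_def
    by (simp add: poly_sum sum_distrib_left sum_divide_distrib mult_ac)
qed

section \<open>Watson's lemma for integrals over cosh\<close>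

lemma bessel_int_of_real:
  assumes x: "x > 0"
  shows "bessel_int \<mu> (of_real x) = of_real (LBINT t. cosh (\<mu> * t) * exp (- x * cosh t))"
proof -
  let ?E = "\<lambda>\<mu> t. exp (\<mu> * t - x * cosh t)"
  have E: "exp (complex_of_real (\<mu> * t) - of_real x * of_real (cosh t)) = of_real (?E \<mu> t)" for \<mu> t
    by (simp flip: exp_of_real)
  have real: "bessel_int \<mu> (of_real x) = of_real (LBINT t. ?E \<mu> t)" for \<mu>
    unfolding bessel_int_def E by (rule integral_complex_of_real)
  have int: "integrable lborel (?E \<mu>)" for \<mu>
    using integrable_norm[OF integrable_bessel_int[of "of_real x" \<mu>]] x by simp
  have eq: "cosh (\<mu> * t) * exp (- x * cosh t) = (?E \<mu> t + ?E (- \<mu>) t) / 2" for t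
    by (simp add: cosh_field_def[of "\<mu> * t"] exp_diff exp_minus field_simps)
  have "(LBINT t. cosh (\<mu> * t) * exp (- x * cosh t)) = ((LBINT t. ?E \<mu> t) + (LBINT t. ?E (- \<mu>) t)) / 2"
    unfolding eq using int[of \<mu>] int[of "- \<mu>"] by simp
  also have "(LBINT t. ?E (- \<mu>) t) = (LBINT t. ?E \<mu> t)"
    using bessel_int_minus[of \<mu> "of_real x"] unfolding real of_real_eq_iff .
  finally show ?thesis by (simp add: real)
qed

lemma Gamma_half_Suc: "Gamma (real (Suc j) + 1 / 2) = (real j + 1 / 2) * Gamma (real j + 1 / 2)"
proof -
  have "real j + 1 / 2 \<notin> \<int>\<^sub>\<le>\<^sub>0" by (auto dest: nonpos_Ints_nonpos)
  from Gamma_plus1[OF this] show ?thesis by (simp add: add_ac)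
qed

lemma Gamma_half_pos: "Gamma (real j + 1 / 2) > 0"
  by (rule Gamma_real_pos) simp

text \<open>
  In terms of \<open>s = cosh t - 1 \<ge> 0\<close>, these are \<open>sqrt 2\<close> times the integrals of \<open>s\<^bsup>r - 1/2\<^esup> exp (- x s)\<close>: the measure \<open>dt\<close> is
  \<open>ds / sqrt (s (s + 2))\<close>, and the factor \<open>cosh (t / 2)\<close> cancels \<open>sqrt (s + 2)\<close> up to a constant. Staying with the
  variable \<open>t\<close> avoids the singularity at \<open>s = 0\<close>.
\<close>

definition cosh_moment :: "nat \<Rightarrow> real \<Rightarrow> real" where
  "cosh_moment r x = (LBINT t. (cosh t - 1) ^ r * cosh (t / 2) * exp (- x * (cosh t - 1)))"

lemma cosh_half_le: "cosh (t / 2) \<le> cosh (t :: real)"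
  using cosh_real_nonneg_le_iff[of "t / 2" t] cosh_real_nonneg_le_iff[of "- t / 2" "- t"]
  by (cases "t \<ge> 0") auto

lemma abs_sinh_le_cosh: "\<bar>sinh t\<bar> \<le> cosh (t :: real)"
  using sinh_le_cosh_real[of t] sinh_le_cosh_real[of "- t"] by (auto simp: abs_if)

lemma cosh_decaying_exp_shifted: "cosh_decaying x (\<lambda>t. exp (- x * (cosh t - 1)))"
  by (intro cosh_decayingI[where C = "exp x" and m = 0]) (simp add: mult_exp_exp algebra_simps)

lemma cosh_decaying_moment:
  fixes g :: "real \<Rightarrow> real"
  assumes "\<And>t. \<bar>g t\<bar> \<le> C * cosh t ^ m"
  shows "cosh_decaying x (\<lambda>t. g t * cosh (t / 2) * exp (- x * (cosh t - 1)))"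
proof (rule cosh_decaying_times[OF cosh_decaying_exp_shifted])
  fix t :: real
  have "\<bar>g t\<bar> * cosh (t / 2) \<le> (C * cosh t ^ m) * cosh t"
    using assms[of t] order_trans[OF abs_ge_zero assms[of t]] cosh_half_le[of t] by (intro mult_mono) auto
  then show "norm (g t * cosh (t / 2)) \<le> C * cosh t ^ (m + 1)"
    by (simp add: abs_mult mult_ac)
qed

lemma cosh_minus_one_power_le: "\<bar>(cosh t - 1) ^ r\<bar> \<le> 1 * cosh (t::real) ^ r"
  using cosh_real_ge_1[of t] by (auto simp: power_abs intro!: power_mono)

lemma integrable_cosh_moment:
  fixes x :: real
  assumes "x > 0"
  shows "integrable lborel (\<lambda>t. (cosh t - 1) ^ r * cosh (t / 2) * exp (- x * (cosh t - 1)))"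
  by (rule integrable_cosh_decaying[OF _ assms], rule cosh_decaying_moment, rule cosh_minus_one_power_le) measurable

text \<open>
  Integrate the derivative of \<open>s\<^sup>r sinh (t / 2) exp (- x s)\<close> with \<open>s = cosh t - 1\<close>. The key identity is
  \<open>sinh t sinh (t / 2) = s cosh (t / 2)\<close>.
\<close>

lemma cosh_moment_Suc:
  assumes x: "x > 0"
  shows "x * cosh_moment (Suc r) x = (real r + 1 / 2) * cosh_moment r x"
proof -
  let ?g = "\<lambda>r t. (cosh t - 1) ^ r * cosh (t / 2) * exp (- x * (cosh t - 1))"
  let ?F = "\<lambda>t. (cosh t - 1) ^ r * sinh (t / 2) * exp (- x * (cosh t - 1))"
  let ?f = "\<lambda>t. (real r + 1 / 2) * ?g r t + (- x) * ?g (Suc r) t"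
  have dec: "cosh_decaying x (\<lambda>t. c * ?g r t)" for c r
    by (rule cosh_decaying_times[OF cosh_decaying_moment[OF cosh_minus_one_power_le], of _ "\<bar>c\<bar>" 0]) simp
  have "(LBINT t. ?f t) = 0"
  proof (rule integral_derivative_cosh_decaying[OF x])
    show "cosh_decaying x ?F"
    proof (rule cosh_decaying_times[OF cosh_decaying_exp_shifted])
      fix t :: real
      have "\<bar>(cosh t - 1) ^ r\<bar> * \<bar>sinh (t / 2)\<bar> \<le> (1 * cosh t ^ r) * cosh t"
        using cosh_minus_one_power_le[of t r] abs_sinh_le_cosh[of "t / 2"] cosh_half_le[of t]
        by (intro mult_mono) auto
      then show "norm ((cosh t - 1) ^ r * sinh (t / 2)) \<le> 1 * cosh t ^ (r + 1)"
        by (simp add: abs_mult mult_ac)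
    qed
    show "cosh_decaying x ?f" by (intro cosh_decaying_add dec)
    show "continuous_on UNIV ?f" by (intro continuous_intros) auto
    show "(?F has_vector_derivative ?f t) (at t)" for t
    proof -
      let ?s = "cosh t - 1" and ?e = "exp (- x * (cosh t - 1))"
      have sh: "sinh t * sinh (t / 2) = ?s * cosh (t / 2)"
      proof -
        have "?s = 2 * (sinh (t / 2))\<^sup>2"
          using cosh_double[of "t / 2"] by (simp add: cosh_square_eq)
        then show ?thesis using sinh_double[of "t / 2"] by (simp add: power2_eq_square)
      qed
      have "real r * ?s ^ (r - 1) * (sinh t * sinh (t / 2)) = real r * ?s ^ r * cosh (t / 2)"
        unfolding sh by (cases r) auto
      moreover have "x * ?s ^ r * (sinh t * sinh (t / 2)) = x * ?s ^ Suc r * cosh (t / 2)"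
        unfolding sh by simp
      moreover have "?f t = (real r * ?s ^ r * cosh (t / 2) + ?s ^ r * cosh (t / 2) / 2
          - x * ?s ^ Suc r * cosh (t / 2)) * ?e"
        by (simp add: algebra_simps)
      ultimately have f: "?f t = (real r * ?s ^ (r - 1) * (sinh t * sinh (t / 2)) + ?s ^ r * cosh (t / 2) / 2
          - x * ?s ^ r * (sinh t * sinh (t / 2))) * ?e"
        by (simp only:)
      have "(?F has_real_derivative ?f t) (at t)"
        unfolding f by (auto intro!: derivative_eq_intros simp: algebra_simps)
      then show ?thesis by (simp add: has_real_derivative_iff_has_vector_derivative)
    qed
  qed
  moreover have "(LBINT t. ?f t) = (real r + 1 / 2) * cosh_moment r x + (- x) * cosh_moment (Suc r) x"
    unfolding cosh_moment_def using integrable_cosh_moment[OF x]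
    by (subst Bochner_Integration.integral_add) (auto simp del: power_Suc)
  ultimately show ?thesis by simp
qed

lemma cosh_moment_eq:
  assumes x: "x > 0"
  shows "cosh_moment r x = sqrt 2 * Gamma (real r + 1 / 2) / (sqrt x * x ^ r)"
proof (induction r)
  case 0
  have "cosh_moment 0 x = exp x * (LBINT t. cosh (1/2 * t) * exp (- x * cosh t))"
    unfolding cosh_moment_def integral_mult_right_zero[symmetric]
    by (intro Bochner_Integration.integral_cong refl) (simp add: mult_exp_exp algebra_simps)
  then have "complex_of_real ((cosh_moment 0 x)\<^sup>2) = (of_real (exp x))\<^sup>2 * (bessel_int (1/2) (of_real x))\<^sup>2"
    using x by (simp add: bessel_int_of_real power_mult_distrib)
  also have "\<dots> = of_real (2 * pi / x)"
    using x by (simp add: bessel_int_half_squared exp_double[symmetric] exp_minus field_simps flip: exp_of_real)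
  finally have "(cosh_moment 0 x)\<^sup>2 = 2 * pi / x" unfolding of_real_eq_iff .
  moreover have "cosh_moment 0 x \<ge> 0"
    unfolding cosh_moment_def by (intro integral_nonneg_AE) auto
  ultimately have "cosh_moment 0 x = sqrt (2 * pi / x)"
    by (metis real_sqrt_abs abs_of_nonneg)
  then show ?case
    by (simp add: Gamma_one_half_real real_sqrt_mult real_sqrt_divide)
next
  case (Suc r)
  have "x * cosh_moment (Suc r) x = (real r + 1 / 2) * (sqrt 2 * Gamma (real r + 1 / 2) / (sqrt x * x ^ r))"
    using cosh_moment_Suc[OF x] Suc by simp
  also have "(real r + 1 / 2) * (sqrt 2 * Gamma (real r + 1 / 2) / (sqrt x * x ^ r))
      = sqrt 2 * Gamma (real (Suc r) + 1 / 2) / (sqrt x * x ^ r)"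
    unfolding Gamma_half_Suc by simp
  finally show ?case using x by (simp add: field_simps)
qed

lemma has_fps_expansion_remainder_local:
  fixes f :: "real \<Rightarrow> real"
  assumes "f has_fps_expansion F"
  obtains A \<delta> where "\<delta> > 0" "\<And>s. \<bar>s\<bar> < \<delta> \<Longrightarrow> \<bar>f s - (\<Sum>r<R. fps_nth F r * s ^ r)\<bar> \<le> A * \<bar>s\<bar> ^ R"
proof -
  define g where "g = eval_fps (fps_shift R F)"
  have rad: "fps_conv_radius F > 0" using assms by (simp add: has_fps_expansion_def)
  have g: "g has_fps_expansion fps_shift R F"
    unfolding g_def using rad by (intro eval_fps_has_fps_expansion) simp
  have "(\<lambda>s. (\<Sum>r<R. fps_nth F r * s ^ r) + s ^ R * g s) has_fps_expansion
          (\<Sum>r<R. fps_const (fps_nth F r) * fps_X ^ r) + fps_X ^ R * fps_shift R F"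
    by (intro fps_expansion_intros g)
  also have "(\<Sum>r<R. fps_const (fps_nth F r) * fps_X ^ r) + fps_X ^ R * fps_shift R F = F"
  proof (rule fps_ext)
    fix n
    show "fps_nth ((\<Sum>r<R. fps_const (fps_nth F r) * fps_X ^ r) + fps_X ^ R * fps_shift R F) n = fps_nth F n"
      by (auto simp: fps_sum_nth fps_X_power_mult_nth if_distrib cong: if_cong)
  qed
  finally have "\<forall>\<^sub>F s in nhds 0. eval_fps F s = (\<Sum>r<R. fps_nth F r * s ^ r) + s ^ R * g s"
    by (simp add: has_fps_expansion_def)
  moreover have "\<forall>\<^sub>F s in nhds 0. eval_fps F s = f s"
    using assms by (simp add: has_fps_expansion_def)
  moreover have "\<forall>\<^sub>F s in nhds 0. \<bar>g s - g 0\<bar> < 1"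
  proof -
    have "isCont g 0" using has_fps_expansion_imp_continuous[OF g, of UNIV] by simp
    then have "(g \<longlongrightarrow> g 0) (nhds 0)" by (simp add: isCont_def tendsto_nhds_iff)
    from tendstoD[OF this, of 1] show ?thesis by (simp add: dist_real_def)
  qed
  ultimately have "\<forall>\<^sub>F s in nhds 0. \<bar>f s - (\<Sum>r<R. fps_nth F r * s ^ r)\<bar> \<le> (1 + \<bar>g 0\<bar>) * \<bar>s\<bar> ^ R"
  proof eventually_elim
    case (elim s)
    then have "\<bar>f s - (\<Sum>r<R. fps_nth F r * s ^ r)\<bar> = \<bar>g s\<bar> * \<bar>s\<bar> ^ R"
      by (simp add: abs_mult power_abs)
    also have "\<dots> \<le> (1 + \<bar>g 0\<bar>) * \<bar>s\<bar> ^ R"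
      using elim by (intro mult_right_mono) auto
    finally show ?case .
  qed
  then obtain \<delta> where "\<delta> > 0" "\<And>s. dist s 0 < \<delta> \<Longrightarrow> \<bar>f s - (\<Sum>r<R. fps_nth F r * s ^ r)\<bar> \<le> (1 + \<bar>g 0\<bar>) * \<bar>s\<bar> ^ R"
    unfolding eventually_nhds_metric by blast
  then show ?thesis using that[of \<delta> "1 + \<bar>g 0\<bar>"] by simp
qed

text \<open>
  The Taylor estimate near 0 becomes global: away from 0 the factor \<open>s\<^sup>R\<close> is bounded below, and both the
  function and its Taylor polynomial grow at most like a power of \<open>1 + s\<close>. This form of the error can
  be integrated against the moments term by term.
\<close>

lemma has_fps_expansion_remainder:
  fixes f :: "real \<Rightarrow> real"
  assumes F: "f has_fps_expansion F" and growth: "\<And>s. s \<ge> 0 \<Longrightarrow> \<bar>f s\<bar> \<le> B * (1 + s) ^ m"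
  obtains A where "A \<ge> 0"
    "\<And>s. s \<ge> 0 \<Longrightarrow> \<bar>f s - (\<Sum>r<R. fps_nth F r * s ^ r)\<bar> \<le> A * (s ^ R * (1 + s) ^ (m + R))"
proof -
  obtain A \<delta> where \<delta>: "\<delta> > 0" and A: "\<And>s. \<bar>s\<bar> < \<delta> \<Longrightarrow> \<bar>f s - (\<Sum>r<R. fps_nth F r * s ^ r)\<bar> \<le> A * \<bar>s\<bar> ^ R"
    using has_fps_expansion_remainder_local[OF F] by blast
  define B' where "B' = B + (\<Sum>r<R. \<bar>fps_nth F r\<bar>)"
  have B0: "B \<ge> 0" using order_trans[OF abs_ge_zero growth[of 0]] by simp
  then have B': "B' \<ge> 0" unfolding B'_def by (simp add: sum_nonneg)
  show ?thesis
  proof (rule that[of "\<bar>A\<bar> + B' / \<delta> ^ R"])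
    fix s :: real assume s: "s \<ge> 0"
    let ?w = "s ^ R * (1 + s) ^ (m + R)"
    have w: "?w \<ge> 0" using s by simp
    show "\<bar>f s - (\<Sum>r<R. fps_nth F r * s ^ r)\<bar> \<le> (\<bar>A\<bar> + B' / \<delta> ^ R) * ?w"
    proof (cases "s < \<delta>")
      case True
      have "A * \<bar>s\<bar> ^ R \<le> \<bar>A\<bar> * ?w"
        using s by (intro mult_mono) (auto simp: mult_le_cancel_left1 intro!: one_le_power)
      also have "\<dots> \<le> (\<bar>A\<bar> + B' / \<delta> ^ R) * ?w"
        using B' \<delta> w by (intro mult_right_mono) auto
      finally show ?thesis using A[of s] True s by linarith
    next
      case False
      have "\<bar>f s\<bar> \<le> B * (1 + s) ^ (m + R)"
        by (rule order_trans[OF growth[OF s]]) (use s B0 in \<open>auto intro!: mult_left_mono power_increasing\<close>)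
      moreover have "\<bar>\<Sum>r<R. fps_nth F r * s ^ r\<bar> \<le> (\<Sum>r<R. \<bar>fps_nth F r\<bar> * (1 + s) ^ (m + R))"
      proof (rule order_trans[OF sum_abs], rule sum_mono)
        fix r assume "r \<in> {..<R}"
        then have "s ^ r \<le> (1 + s) ^ (m + R)"
          using s by (intro order_trans[OF power_mono[of s "1 + s" r] power_increasing]) auto
        then show "\<bar>fps_nth F r * s ^ r\<bar> \<le> \<bar>fps_nth F r\<bar> * (1 + s) ^ (m + R)"
          using s by (simp add: abs_mult mult_left_mono)
      qed
      ultimately have "\<bar>f s - (\<Sum>r<R. fps_nth F r * s ^ r)\<bar> \<le> B' * (1 + s) ^ (m + R)"
        unfolding B'_def by (simp add: sum_distrib_right distrib_right)
      also have "\<dots> \<le> B' * ((s / \<delta>) ^ R * (1 + s) ^ (m + R))"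
        using False \<delta> s B' by (intro mult_left_mono) (auto simp: mult_le_cancel_right1 intro!: one_le_power)
      also have "\<dots> = B' / \<delta> ^ R * ?w" by (simp add: power_divide)
      also have "\<dots> \<le> (\<bar>A\<bar> + B' / \<delta> ^ R) * ?w"
        using w by (intro mult_right_mono) auto
      finally show ?thesis .
    qed
  qed (use B' \<delta> in auto)
qed

text \<open>
  Since \<open>sqrt (1 + cosh t) = sqrt 2 cosh (t / 2)\<close>, the integrand is \<open>sqrt 2 cosh (t / 2) exp (- x cosh t)\<close>
  times \<open>f(s) = \<phi> (1 + s) / sqrt (2 + s)\<close> at \<open>s = cosh t - 1\<close>. The Taylor polynomial of \<open>f\<close> integrates to the
  moments, and the remainder is at most \<open>A s\<^sup>R (1 + s)\<^bsup>m + R\<^esup>\<close>, which is a combination of moments of index at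
  least \<open>R\<close>.
\<close>

lemma watson_cosh:
  fixes \<phi> :: "real \<Rightarrow> real"
  assumes cont: "continuous_on {1..} \<phi>" and growth: "\<And>y. y \<ge> 1 \<Longrightarrow> \<bar>\<phi> y\<bar> \<le> B * y ^ m"
    and F: "(\<lambda>s. \<phi> (1 + s) / sqrt (2 + s)) has_fps_expansion F"
  obtains C where "\<And>x. x \<ge> 1 \<Longrightarrow>
    \<bar>sqrt x * exp x * (LBINT t. \<phi> (cosh t) * exp (- x * cosh t))
      - (\<Sum>r<R. 2 * Gamma (real r + 1 / 2) * fps_nth F r / x ^ r)\<bar> \<le> C / x ^ R"
proof -
  define f where "f = (\<lambda>s. \<phi> (1 + s) / sqrt (2 + s))"
  have B0: "B \<ge> 0" using order_trans[OF abs_ge_zero growth[of 1]] by simp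
  have "\<bar>f s\<bar> \<le> B * (1 + s) ^ m" if "s \<ge> 0" for s
  proof -
    have "\<bar>f s\<bar> = \<bar>\<phi> (1 + s)\<bar> / sqrt (2 + s)" using that by (simp add: f_def)
    also have "\<dots> \<le> \<bar>\<phi> (1 + s)\<bar> / 1" using that by (intro divide_left_mono) auto
    also have "\<dots> \<le> B * (1 + s) ^ m" using growth[of "1 + s"] that by simp
    finally show ?thesis .
  qed
  from has_fps_expansion_remainder[OF F[folded f_def] this] obtain A where A: "A \<ge> 0"
    "\<And>s. s \<ge> 0 \<Longrightarrow> \<bar>f s - (\<Sum>r<R. fps_nth F r * s ^ r)\<bar> \<le> A * (s ^ R * (1 + s) ^ (m + R))"
    by blast
  define G where "G = (\<lambda>i. Gamma (real (R + i) + 1 / 2))"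
  have G: "G i > 0" for i unfolding G_def by (rule Gamma_real_pos) simp
  show ?thesis
  proof (rule that)
    fix x :: real assume x1: "x \<ge> 1"
    then have x: "x > 0" by simp
    let ?s = "\<lambda>t::real. cosh t - 1" and ?e = "\<lambda>t. exp (- x * (cosh t - 1))"
    have phi: "\<phi> (cosh t) = sqrt 2 * (f (?s t) * cosh (t / 2))" for t
    proof -
      have "1 + cosh t = 2 * (cosh (t / 2))\<^sup>2" using cosh_double_cosh[of "t / 2"] by simp
      then have "sqrt (1 + cosh t) = sqrt 2 * cosh (t / 2)" by (simp add: real_sqrt_mult)
      moreover have "sqrt (1 + cosh t) \<noteq> 0" using cosh_real_ge_1[of t] by simp
      ultimately show ?thesis unfolding f_def by (simp add: field_simps)
    qed
    have meas: "(\<lambda>t. \<phi> (cosh t)) \<in> borel_measurable borel"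
      by (intro borel_measurable_continuous_onI continuous_on_compose2[OF cont] continuous_intros)
         (auto simp: cosh_real_ge_1)
    have "(\<lambda>t. f (?s t) * cosh (t / 2)) = (\<lambda>t. \<phi> (cosh t) / sqrt 2)" by (simp add: phi)
    with meas have measf [measurable]: "(\<lambda>t. f (?s t) * cosh (t / 2)) \<in> borel_measurable borel" by simp
    have "cosh_decaying x (\<lambda>t. \<phi> (cosh t) / sqrt 2 * ?e t)"
    proof (rule cosh_decaying_times[OF cosh_decaying_exp_shifted])
      show "norm (\<phi> (cosh t) / sqrt 2) \<le> B * cosh t ^ m" for t
        using growth[OF cosh_real_ge_1[of t]] mult_left_mono[of 1 "sqrt 2" "B * cosh t ^ m"] B0
        by (simp add: divide_simps)
    qed
    then have intf: "integrable lborel (\<lambda>t. f (?s t) * cosh (t / 2) * ?e t)"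
      using x meas by (intro integrable_cosh_decaying) (auto simp: phi)
    have intm: "integrable lborel (\<lambda>t. ?s t ^ r * cosh (t / 2) * ?e t)" for r
      by (rule integrable_cosh_moment[OF x])
    have sums: "(\<Sum>r<R. fps_nth F r * cosh_moment r x)
        = (LBINT t. \<Sum>r<R. fps_nth F r * (?s t ^ r * cosh (t / 2) * ?e t))"
      unfolding cosh_moment_def using intm by (subst Bochner_Integration.integral_sum) auto
    let ?rem = "\<lambda>t. (f (?s t) - (\<Sum>r<R. fps_nth F r * ?s t ^ r)) * cosh (t / 2) * ?e t"
    have "exp x * (LBINT t. \<phi> (cosh t) * exp (- x * cosh t)) = sqrt 2 * (LBINT t. f (?s t) * cosh (t / 2) * ?e t)"
      unfolding phi integral_mult_right_zero[symmetric]
      by (intro Bochner_Integration.integral_cong refl) (simp add: mult_exp_exp algebra_simps)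
    moreover have "(\<Sum>r<R. 2 * Gamma (real r + 1 / 2) * fps_nth F r / x ^ r)
        = sqrt x * (sqrt 2 * (\<Sum>r<R. fps_nth F r * cosh_moment r x))"
      unfolding sum_distrib_left
      by (intro sum.cong refl) (use x in \<open>simp add: cosh_moment_eq field_simps\<close>)
    moreover have "(LBINT t. f (?s t) * cosh (t / 2) * ?e t) - (\<Sum>r<R. fps_nth F r * cosh_moment r x) = (LBINT t. ?rem t)"
      unfolding sums using intf intm
      by (subst Bochner_Integration.integral_diff[symmetric]) (auto simp: sum_distrib_right sum_distrib_left algebra_simps)
    ultimately have eq: "sqrt x * exp x * (LBINT t. \<phi> (cosh t) * exp (- x * cosh t))
      - (\<Sum>r<R. 2 * Gamma (real r + 1 / 2) * fps_nth F r / x ^ r) = sqrt x * (sqrt 2 * (LBINT t. ?rem t))"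
      by (simp add: algebra_simps)
    have "\<bar>LBINT t. ?rem t\<bar> \<le> (LBINT t. \<bar>?rem t\<bar>)"
      by (rule integral_abs_bound)
    also have "\<dots> \<le> (LBINT t. \<Sum>i\<le>m + R. A * (real (m + R choose i) * (?s t ^ (R + i) * cosh (t / 2) * ?e t)))"
    proof (rule integral_mono)
      have "integrable lborel (\<lambda>t. f (?s t) * cosh (t / 2) * ?e t - (\<Sum>r<R. fps_nth F r * (?s t ^ r * cosh (t / 2) * ?e t)))"
        using intf intm by auto
      then show "integrable lborel (\<lambda>t. \<bar>?rem t\<bar>)"
        by (intro integrable_abs) (simp add: sum_distrib_right sum_distrib_left algebra_simps)
      show "integrable lborel (\<lambda>t. \<Sum>i\<le>m + R. A * (real (m + R choose i) * (?s t ^ (R + i) * cosh (t / 2) * ?e t)))"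
        using intm by auto
      fix t :: real
      have s: "?s t \<ge> 0" using cosh_real_ge_1[of t] by simp
      have "\<bar>?rem t\<bar> = \<bar>f (?s t) - (\<Sum>r<R. fps_nth F r * ?s t ^ r)\<bar> * (cosh (t / 2) * ?e t)"
        by (simp add: abs_mult)
      also have "\<dots> \<le> (A * (?s t ^ R * (1 + ?s t) ^ (m + R))) * (cosh (t / 2) * ?e t)"
        by (intro mult_right_mono A(2)[OF s]) simp
      also have "(1 + ?s t) ^ (m + R) = (\<Sum>i\<le>m + R. real (m + R choose i) * ?s t ^ i)"
        using binomial_ring[of "?s t" 1 "m + R"] by (simp add: add.commute)
      finally show "\<bar>?rem t\<bar> \<le> (\<Sum>i\<le>m + R. A * (real (m + R choose i) * (?s t ^ (R + i) * cosh (t / 2) * ?e t)))"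
        by (simp add: sum_distrib_left sum_distrib_right power_add mult_ac)
    qed
    also have "\<dots> = (\<Sum>i\<le>m + R. A * (real (m + R choose i) * cosh_moment (R + i) x))"
      unfolding cosh_moment_def using intm by (subst Bochner_Integration.integral_sum) auto
    finally have "sqrt x * (sqrt 2 * \<bar>LBINT t. ?rem t\<bar>)
        \<le> sqrt x * (sqrt 2 * (\<Sum>i\<le>m + R. A * (real (m + R choose i) * cosh_moment (R + i) x)))"
      using x by (intro mult_left_mono) auto
    also have "\<dots> = (\<Sum>i\<le>m + R. 2 * A * real (m + R choose i) * G i / x ^ (R + i))"
      unfolding sum_distrib_left G_def
      by (intro sum.cong refl) (use x in \<open>simp add: cosh_moment_eq field_simps\<close>)
    also have "\<dots> \<le> (\<Sum>i\<le>m + R. 2 * A * real (m + R choose i) * G i / x ^ R)"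
      using x1 A(1) G by (intro sum_mono divide_left_mono power_increasing mult_nonneg_nonneg mult_pos_pos)
         (auto intro: less_imp_le[OF G])
    finally show "\<bar>sqrt x * exp x * (LBINT t. \<phi> (cosh t) * exp (- x * cosh t))
      - (\<Sum>r<R. 2 * Gamma (real r + 1 / 2) * fps_nth F r / x ^ r)\<bar>
      \<le> (\<Sum>i\<le>m + R. 2 * A * real (m + R choose i) * G i) / x ^ R"
      unfolding eq using x by (simp add: abs_mult sum_divide_distrib)
  qed
qed

section \<open>The Taylor coefficients\<close>

text \<open>
  The link between coefficients given as iterated derivatives and formal power series. It also shows that the
  series is unique, so once some expansion of a function exists, its coefficients are known.
\<close>

lemma has_fps_expansion_nth_deriv:
  fixes f :: "real \<Rightarrow> real"
  assumes "f has_fps_expansion F"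
  shows "fps_nth F n = (deriv ^^ n) f 0 / fact n"
  using assms
proof (induction n arbitrary: f F)
  case 0
  then have "\<forall>\<^sub>F x in nhds 0. eval_fps F x = f x" by (simp add: has_fps_expansion_def)
  from eventually_nhds_x_imp_x[OF this] show ?case by (simp add: eval_fps_at_0)
next
  case (Suc n)
  have "fps_nth (fps_deriv F) n = (deriv ^^ n) (deriv f) 0 / fact n"
    by (rule Suc.IH[OF has_fps_expansion_deriv[OF Suc.prems]])
  then show ?case by (simp add: funpow_Suc_right field_simps del: funpow.simps of_nat_Suc)
qed

lemma has_fps_expansion_powr_add:
  fixes a c :: real
  assumes "c > 0"
  shows "(\<lambda>x. (c + x) powr a) has_fps_expansion Abs_fps (\<lambda>n. (a gchoose n) * c powr (a - real n))"
proof (rule has_fps_expansionI)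
  have "\<forall>\<^sub>F x in nhds 0. \<bar>x\<bar> < c"
    using assms by (auto simp: eventually_nhds_metric dist_real_def)
  then show "\<forall>\<^sub>F x in nhds 0. (\<lambda>n. fps_nth (Abs_fps (\<lambda>n. (a gchoose n) * c powr (a - real n))) n * x ^ n) sums (c + x) powr a"
    by eventually_elim (use gen_binomial_real'' in simp)
qed

lemma has_fps_expansion_eventually_eq:
  assumes "f has_fps_expansion F" "\<forall>\<^sub>F x in nhds 0. f x = g x"
  shows "g has_fps_expansion F"
proof -
  have "\<forall>\<^sub>F x in nhds 0. eval_fps F x = g x"
    using assms(2) assms(1)[unfolded has_fps_expansion_def, THEN conjunct2] by eventually_elim simp
  then show ?thesis using assms(1) by (simp add: has_fps_expansion_def)
qed

lemma eventually_nhds_0_gt_minus: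
  "c > 0 \<Longrightarrow> \<forall>\<^sub>F x in nhds (0::real). x > - c"
  by (auto simp: eventually_nhds_metric dist_real_def intro!: exI[of _ c])

lemma has_fps_expansion_inverse_sqrt:
  "(\<lambda>x::real. 1 / sqrt (x + 2)) has_fps_expansion Abs_fps (\<lambda>n. ((-1/2) gchoose n) * 2 powr (-1/2 - real n))"
proof (rule has_fps_expansion_eventually_eq[OF has_fps_expansion_powr_add])
  show "\<forall>\<^sub>F x in nhds 0. (2 + x) powr (- 1 / 2) = 1 / sqrt (x + 2)"
    using eventually_nhds_0_gt_minus[of 2, simplified]
    by eventually_elim (simp add: powr_half_sqrt[symmetric] powr_minus_divide[symmetric] add.commute)
qed simp

lemma has_fps_expansion_sqrt:
  "(\<lambda>x::real. sqrt (x + 2)) has_fps_expansion Abs_fps (\<lambda>n. ((1/2) gchoose n) * 2 powr (1/2 - real n))"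
proof (rule has_fps_expansion_eventually_eq[OF has_fps_expansion_powr_add])
  show "\<forall>\<^sub>F x in nhds 0. (2 + x) powr (1 / 2) = sqrt (x + 2)"
    using eventually_nhds_0_gt_minus[of 2, simplified]
    by eventually_elim (simp add: powr_half_sqrt[symmetric] add.commute)
qed simp

definition b_fps :: "nat \<Rightarrow> real fps" where "b_fps N = Abs_fps (\<lambda>k. b_coeff k N)"

definition d_fps :: "nat \<Rightarrow> real fps" where "d_fps N = Abs_fps (\<lambda>k. d_coeff k N)"

lemma has_fps_expansion_one_plus_power:
  "(\<lambda>x::real. (x + 1) ^ N) has_fps_expansion (fps_X + 1) ^ N"
  by (induction N) (auto intro!: fps_expansion_intros)

lemma has_fps_expansion_b_fps: "(\<lambda>x. (x + 1) ^ N / sqrt (x + 2)) has_fps_expansion b_fps N"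
proof -
  from has_fps_expansion_mult[OF has_fps_expansion_one_plus_power has_fps_expansion_inverse_sqrt] obtain F
    where F: "(\<lambda>x. (x + 1) ^ N / sqrt (x + 2)) has_fps_expansion F" by auto
  have "F = b_fps N"
    by (rule fps_ext) (simp add: b_fps_def b_coeff_def has_fps_expansion_nth_deriv[OF F])
  with F show ?thesis by simp
qed

lemma has_fps_expansion_d_fps: "(\<lambda>x. sqrt (x + 2) * (x + 1) ^ N) has_fps_expansion d_fps N"
proof -
  from has_fps_expansion_mult[OF has_fps_expansion_sqrt has_fps_expansion_one_plus_power] obtain F
    where F: "(\<lambda>x. sqrt (x + 2) * (x + 1) ^ N) has_fps_expansion F" by auto
  have "F = d_fps N"
    by (rule fps_ext) (simp add: d_fps_def d_coeff_def has_fps_expansion_nth_deriv[OF F])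
  with F show ?thesis by simp
qed

text \<open>
  This is \<open>((x + 1)\<^sup>2 - 1) / sqrt (x + 2) = x sqrt (x + 2)\<close>, multiplied by \<open>(x + 1)\<^sup>N\<close>.
\<close>

lemma b_fps_diff: "b_fps (N + 2) - b_fps N = fps_X * d_fps N"
proof -
  have "(\<lambda>x. x * (sqrt (x + 2) * (x + 1) ^ N)) has_fps_expansion fps_X * d_fps N"
    by (intro fps_expansion_intros has_fps_expansion_d_fps)
  moreover have "\<forall>\<^sub>F x in nhds 0. x * (sqrt (x + 2) * (x + 1) ^ N)
      = (x + 1) ^ (N + 2) / sqrt (x + 2) - (x + 1) ^ N / sqrt (x + 2)"
    using eventually_nhds_0_gt_minus[of 2, simplified]
  proof eventually_elim
    case (elim x)
    then have "sqrt (x + 2) \<noteq> 0" "sqrt (x + 2) * sqrt (x + 2) = x + 2" by auto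
    then have s: "sqrt (x + 2) = (x + 2) / sqrt (x + 2)" by (simp add: field_simps)
    have "x * (sqrt (x + 2) * (x + 1) ^ N) = x * ((x + 2) / sqrt (x + 2) * (x + 1) ^ N)"
      by (subst s) simp
    also have "\<dots> = ((x + 1) ^ (N + 2) - (x + 1) ^ N) / sqrt (x + 2)"
      by (simp add: algebra_simps power2_eq_square)
    finally show ?case by (simp add: diff_divide_distrib)
  qed
  ultimately have 1: "(\<lambda>x. (x + 1) ^ (N + 2) / sqrt (x + 2) - (x + 1) ^ N / sqrt (x + 2)) has_fps_expansion fps_X * d_fps N"
    by (rule has_fps_expansion_eventually_eq)
  have 2: "(\<lambda>x. (x + 1) ^ (N + 2) / sqrt (x + 2) - (x + 1) ^ N / sqrt (x + 2)) has_fps_expansion b_fps (N + 2) - b_fps N"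
    by (intro has_fps_expansion_diff has_fps_expansion_b_fps)
  show ?thesis
    by (rule fps_ext) (simp only: has_fps_expansion_nth_deriv[OF 1] has_fps_expansion_nth_deriv[OF 2])
qed

definition c_fps :: "nat \<Rightarrow> real fps" where "c_fps j = Abs_fps (\<lambda>l. c_coeff l j)"

lemma has_fps_expansion_c_fps: "(\<lambda>x. (1 + x) powr (- 1 / 2 - real j)) has_fps_expansion c_fps j"
  using has_fps_expansion_powr_add[of 1 "- 1 / 2 - real j"] by (simp add: c_fps_def c_coeff_def)

section \<open>The coefficients of the Bessel function\<close>

fun cheb :: "nat \<Rightarrow> real \<Rightarrow> real" where
  "cheb 0 y = 1"
| "cheb (Suc 0) y = y"
| "cheb (Suc (Suc n)) y = 2 * y * cheb (Suc n) y - cheb n y"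

lemma cheb_cosh: "cheb n (cosh t) = cosh (real n * t)"
proof (induction n rule: induct_nat_012)
  case (ge2 n)
  have eqs: "real (Suc (Suc n)) * t = real (Suc n) * t + t" "real n * t = real (Suc n) * t - t"
    by (simp_all add: algebra_simps)
  show ?case
    unfolding cheb.simps ge2 unfolding eqs cosh_add cosh_diff by simp
qed auto

lemma abs_cheb_le:
  assumes "y \<ge> 1"
  shows "\<bar>cheb n y\<bar> \<le> 2 ^ n * y ^ n"
proof -
  obtain t where t: "y = cosh t" using cosh_arcosh_real[OF assms] by metis
  have "cosh (real n * t) \<le> (2 * cosh t) ^ n"
    using exp_le_cosh_power[of "real n" n t] exp_le_cosh_power[of "- real n" n t]
    by (simp add: cosh_field_def[of "real n * t"])
  then show ?thesis by (simp add: t cheb_cosh power_mult_distrib)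
qed

lemma continuous_on_cheb [continuous_intros]: "continuous_on A (cheb n)"
proof (induction n rule: induct_nat_012)
  case 0 then show ?case by (simp add: continuous_on_const cong: continuous_on_cong_simp)
next
  case 1 then show ?case by (simp add: continuous_on_id cong: continuous_on_cong_simp)
next
  case (ge2 n)
  have "cheb (Suc (Suc n)) = (\<lambda>y. 2 * y * cheb (Suc n) y - cheb n y)" by (rule ext) simp
  with ge2 show ?case by (auto intro!: continuous_intros)
qed

text \<open>
  The argument is a real number rather than the natural number \<open>\<nu>\<close> so that the recurrence in the order can be
  used at \<open>x = 0\<close>, where it involves the order \<open>-1\<close>.
\<close>

definition a_prod :: "nat \<Rightarrow> real \<Rightarrow> real" where
  "a_prod j x = (\<Prod>l=1..j. 4 * x\<^sup>2 - (2 * real l - 1)\<^sup>2)"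

lemma a_prod_0 [simp]: "a_prod 0 x = 1" by (simp add: a_prod_def)
lemma a_prod_Suc: "a_prod (Suc j) x = a_prod j x * (4 * x\<^sup>2 - (2 * real j + 1)\<^sup>2)"
  by (simp add: a_prod_def)

lemma a_prod_minus: "a_prod j (- x) = a_prod j x" by (simp add: a_prod_def)

text \<open>
  The product is \<open>(2 x - 2 j + 1) (2 x - 2 j + 3) \<cdots> (2 x + 2 j - 1)\<close>, with \<open>2 j\<close> factors in
  arithmetic progression. Replacing \<open>x\<close> by \<open>x + 1\<close> and \<open>j\<close> by \<open>j + 1\<close> adds two factors at the upper end.
\<close>

lemma a_prod_shift_up: "a_prod (Suc j) (x + 1) = a_prod j x * ((2 * x + 2 * real j + 1) * (2 * x + 2 * real j + 3))"
  by (induction j) (simp add: a_prod_Suc algebra_simps power2_eq_square,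
      simp only: a_prod_Suc[of "Suc _"] a_prod_Suc, simp add: a_prod_Suc algebra_simps power2_eq_square)

lemma a_prod_shift_down: "a_prod (Suc j) (x - 1) = a_prod j x * ((2 * x - 2 * real j - 1) * (2 * x - 2 * real j - 3))"
  using a_prod_shift_up[of j "- x"] a_prod_minus[of "Suc j" "x - 1"]
  by (simp add: a_prod_minus algebra_simps)

lemma a_prod_recurrence:
  "a_prod (Suc j) (x + 1) + a_prod (Suc j) (x - 1)
    = 2 * a_prod (Suc j) x + 8 * (2 * real j + 1) * (real j + 1) * a_prod j x"
proof -
  have "(2 * x + 2 * real j + 1) * (2 * x + 2 * real j + 3) + (2 * x - 2 * real j - 1) * (2 * x - 2 * real j - 3)
      = 2 * (4 * x\<^sup>2 - (2 * real j + 1)\<^sup>2) + 8 * (2 * real j + 1) * (real j + 1)"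
    by (simp add: algebra_simps power2_eq_square)
  then show ?thesis
    unfolding a_prod_shift_up a_prod_shift_down a_prod_Suc[of j x]
    by (simp only: distrib_left[symmetric] mult.left_commute[of _ "a_prod j x"] mult.commute[of _ "a_prod j x"])
qed

definition a_real :: "real \<Rightarrow> nat \<Rightarrow> real" where
  "a_real x j = sqrt (pi / 2) * (a_prod j x / (8 ^ j * fact j))"

lemma a_coeff_eq_a_real: "a_coeff (of_nat \<nu>) j = of_real (a_real (real \<nu>) j)"
  by (simp add: a_coeff_def a_real_def a_prod_def)

lemma a_real_recurrence:
  "a_real (x + 1) (Suc j) + a_real (x - 1) (Suc j) = 2 * a_real x (Suc j) + (2 * real j + 1) * a_real x j"
proof -
  have "a_real (x + 1) (Suc j) + a_real (x - 1) (Suc j)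
      = sqrt (pi / 2) * ((a_prod (Suc j) (x + 1) + a_prod (Suc j) (x - 1)) / (8 ^ Suc j * fact (Suc j)))"
    by (simp add: a_real_def add_divide_distrib algebra_simps)
  also have "\<dots> = sqrt (pi / 2) * (2 * (a_prod (Suc j) x / (8 ^ Suc j * fact (Suc j)))
      + (2 * real j + 1) * (a_prod j x / (8 ^ j * fact j)))"
  proof -
    have eq: "(2 * A + 8 * k * c * P) / (8 * E * (c * G)) = 2 * (A / (8 * E * (c * G))) + k * (P / (E * G))"
      if "c \<noteq> 0" "E \<noteq> 0" "G \<noteq> 0" for c E G A k P :: real
      using that by (simp add: divide_simps)
    have "real j + 1 \<noteq> 0" "(8::real) ^ j \<noteq> 0" "fact j \<noteq> (0::real)" by auto
    note eq = eq[OF this, of "a_prod (Suc j) x" "2 * real j + 1" "a_prod j x"]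
    have "fact (Suc j) = (real j + 1) * fact j" "(8::real) ^ Suc j = 8 * 8 ^ j" by simp_all
    then show ?thesis by (simp only: a_prod_recurrence eq)
  qed
  finally show ?thesis by (simp add: a_real_def algebra_simps)
qed

definition a_fps :: "real \<Rightarrow> real fps" where
  "a_fps x = Abs_fps (\<lambda>j. a_real x j / Gamma (real j + 1 / 2))"

text \<open>
  The same recurrence as \<open>T\<^bsub>\<nu> + 1\<^esub>(y) + T\<^bsub>\<nu> - 1\<^esub>(y) = 2 y T\<^sub>\<nu>(y)\<close> at \<open>y = 1 + s\<close>; together with the value at order
  0 it identifies the series.
\<close>

lemma a_fps_recurrence: "a_fps (x + 1) + a_fps (x - 1) = 2 * (1 + fps_X) * a_fps x"
proof (rule fps_ext)
  fix n
  show "fps_nth (a_fps (x + 1) + a_fps (x - 1)) n = fps_nth (2 * (1 + fps_X) * a_fps x) n"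
  proof (cases n)
    case 0
    then show ?thesis by (simp add: a_fps_def a_real_def)
  next
    case (Suc j)
    have G: "Gamma (real j + 1 / 2) \<noteq> 0" using Gamma_half_pos[of j] by (metis less_irrefl)
    have "fps_nth (2 * (1 + fps_X) * a_fps x) (Suc j) = 2 * (fps_nth (a_fps x) (Suc j) + fps_nth (a_fps x) j)"
      by (simp add: algebra_simps numeral_fps_const)
    also have "\<dots> = (2 * a_real x (Suc j) + (2 * real j + 1) * a_real x j) / Gamma (real (Suc j) + 1 / 2)"
      using G unfolding a_fps_def fps_nth_Abs_fps Gamma_half_Suc by (simp add: divide_simps)
    also have "\<dots> = fps_nth (a_fps (x + 1) + a_fps (x - 1)) (Suc j)"
      unfolding a_real_recurrence[symmetric] by (simp add: a_fps_def add_divide_distrib)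
    finally show ?thesis using Suc by simp
  qed
qed

lemma a_fps_0: "a_fps 0 = Abs_fps (\<lambda>n. ((-1/2) gchoose n) * 2 powr (-1/2 - real n))"
proof (rule fps_ext)
  fix n
  have "a_real 0 n / Gamma (real n + 1 / 2) = ((-1/2) gchoose n) * 2 powr (-1/2 - real n)"
  proof (induction n)
    case 0
    show ?case
      by (simp add: a_real_def Gamma_one_half_real powr_minus_divide powr_half_sqrt real_sqrt_divide)
  next
    case (Suc n)
    have G: "Gamma (real n + 1 / 2) \<noteq> 0" using Gamma_half_pos[of n] by (metis less_irrefl)
    have "a_real 0 (Suc n) / Gamma (real (Suc n) + 1 / 2)
        = a_real 0 n / Gamma (real n + 1 / 2) * ((- 1/2 - real n) / (real n + 1) / 2)"
      using G unfolding Gamma_half_Suc a_real_def a_prod_Suc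
      by (simp add: divide_simps) (simp add: algebra_simps power2_eq_square)
    also have "\<dots> = ((-1/2) gchoose n) * ((- 1/2 - real n) / (real n + 1)) * (2 powr (-1/2 - real n) / 2)"
      unfolding Suc by simp
    also have "((-1/2) gchoose n) * ((- 1/2 - real n) / (real n + 1)) = ((-1/2) gchoose Suc n)"
      by (simp add: gbinomial_Suc_rec gbinomial_absorb_comp field_simps gbinomial_mult_1)
    also have "2 powr (-1/2 - real n) / 2 = 2 powr (-1/2 - real (Suc n))"
    proof -
      have e: "-1/2 - real (Suc n) = (-1/2 - real n) - 1" by simp
      show ?thesis unfolding e powr_diff[of 2 _ 1] by simp
    qed
    finally show ?case .
  qed
  then show "fps_nth (a_fps 0) n = fps_nth (Abs_fps (\<lambda>n. ((-1/2) gchoose n) * 2 powr (-1/2 - real n))) n"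
    by (simp add: a_fps_def)
qed

text \<open>
  The coefficients \<open>a\<^sub>j\<close> arise here from the Chebyshev polynomial: two-step induction with
  \<open>a_fps_recurrence\<close>. At order 1 the recurrence around 0 is used, where the symmetry \<open>a_fps (-1) = a_fps 1\<close>
  makes both terms on the left equal.
\<close>

lemma has_fps_expansion_a_fps:
  "(\<lambda>s. cheb n (1 + s) / sqrt (2 + s)) has_fps_expansion a_fps (real n)"
proof (induction n rule: induct_nat_012)
  case 0
  show ?case using has_fps_expansion_inverse_sqrt by (simp add: a_fps_0 add.commute)
next
  case 1
  have "a_fps (0 - 1) = a_fps 1"
    using a_prod_minus[of _ 1] by (simp add: a_fps_def a_real_def)
  then have "2 * a_fps 1 = 2 * ((1 + fps_X) * a_fps 0)"
    using a_fps_recurrence[of 0] by (simp add: algebra_simps)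
  then have "a_fps 1 = (1 + fps_X) * a_fps 0" by simp
  moreover have "(\<lambda>s. (1 + s) * (1 / sqrt (s + 2))) has_fps_expansion (1 + fps_X) * a_fps 0"
    unfolding a_fps_0 by (intro fps_expansion_intros has_fps_expansion_inverse_sqrt)
  ultimately show ?case by (simp add: add.commute)
next
  case (ge2 n)
  have "a_fps (real (Suc (Suc n))) = 2 * (1 + fps_X) * a_fps (real (Suc n)) - a_fps (real n)"
    using a_fps_recurrence[of "real (Suc n)"] by (simp add: algebra_simps)
  moreover have "(\<lambda>s. 2 * (1 + s) * (cheb (Suc n) (1 + s) / sqrt (2 + s)) - cheb n (1 + s) / sqrt (2 + s))
      has_fps_expansion 2 * (1 + fps_X) * a_fps (real (Suc n)) - a_fps (real n)"
    by (intro fps_expansion_intros ge2)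
  moreover have "(\<lambda>s. 2 * (1 + s) * (cheb (Suc n) (1 + s) / sqrt (2 + s)) - cheb n (1 + s) / sqrt (2 + s))
      = (\<lambda>s. cheb (Suc (Suc n)) (1 + s) / sqrt (2 + s))"
    by (simp add: diff_divide_distrib)
  ultimately show ?case by simp
qed

section \<open>The asymptotic expansion and the coefficients\<close>

definition F_coeff :: "nat \<Rightarrow> nat \<Rightarrow> nat \<Rightarrow> real" where
  "F_coeff N \<nu> s = (\<Sum>j\<le>s. a_real (real \<nu>) j * Gamma (real (s - j) + 1 / 2) * fps_nth (b_fps N * c_fps j) (s - j))"

definition F_real :: "nat \<Rightarrow> nat \<Rightarrow> real \<Rightarrow> real" where
  "F_real N \<nu> x = (LBINT t. cosh t ^ N * (LBINT u. cosh (real \<nu> * u) * exp (- (x * cosh t) * cosh u))) / 4"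

lemma F_int_of_real:
  assumes x: "x > 0"
  shows "F_int N (of_nat \<nu>) (of_real x) = of_real (F_real N \<nu> x)"
proof -
  have "complex_of_real (cosh t ^ N) * bessel_int (real \<nu>) (of_real x * of_real (cosh t))
      = of_real (cosh t ^ N * (LBINT u. cosh (real \<nu> * u) * exp (- (x * cosh t) * cosh u)))" for t
    using bessel_int_of_real[of "x * cosh t" "real \<nu>"] x by simp
  then show ?thesis
    using x unfolding F_real_def by (subst F_int_eq_bessel_int) (simp_all only: integral_complex_of_real Re_complex_of_real, simp)
qed

lemma bessel_asymptotics:
  obtains C where "\<And>w. w \<ge> 1 \<Longrightarrow>
    \<bar>sqrt w * exp w * (LBINT u. cosh (real \<nu> * u) * exp (- w * cosh u))
      - (\<Sum>j<J. 2 * a_real (real \<nu>) j / w ^ j)\<bar> \<le> C / w ^ J"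
proof -
  obtain C where C: "\<And>x. x \<ge> 1 \<Longrightarrow>
    \<bar>sqrt x * exp x * (LBINT t. cheb \<nu> (cosh t) * exp (- x * cosh t))
      - (\<Sum>r<J. 2 * Gamma (real r + 1 / 2) * fps_nth (a_fps (real \<nu>)) r / x ^ r)\<bar> \<le> C / x ^ J"
    using watson_cosh[OF continuous_on_cheb abs_cheb_le has_fps_expansion_a_fps] by blast
  have "2 * Gamma (real r + 1 / 2) * fps_nth (a_fps (real \<nu>)) r = 2 * a_real (real \<nu>) r" for r
  proof -
    have "Gamma (real r + 1 / 2) \<noteq> 0" using Gamma_half_pos[of r] by (metis less_irrefl)
    then show ?thesis by (simp add: a_fps_def)
  qed
  with C show ?thesis by (intro that[of C]) (simp add: cheb_cosh)
qed

lemma cosh_power_asymptotics: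
  obtains C where "\<And>x. x \<ge> 1 \<Longrightarrow>
    \<bar>sqrt x * exp x * (LBINT t. cosh t ^ N * cosh t powr (- 1 / 2 - real j) * exp (- x * cosh t))
      - (\<Sum>r<R. 2 * Gamma (real r + 1 / 2) * fps_nth (b_fps N * c_fps j) r / x ^ r)\<bar> \<le> C / x ^ R"
proof -
  let ?\<phi> = "\<lambda>y::real. y ^ N * y powr (- 1 / 2 - real j)"
  have 1: "continuous_on {1..} ?\<phi>" by (intro continuous_intros) auto
  have 2: "\<bar>?\<phi> y\<bar> \<le> 1 * y ^ N" if "y \<ge> 1" for y
  proof -
    have "y powr (- 1 / 2 - real j) \<le> y powr 0" using that by (intro powr_mono) auto
    then have "y ^ N * y powr (- 1 / 2 - real j) \<le> y ^ N * 1" using that by (intro mult_left_mono) auto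
    then show ?thesis using that by (simp add: abs_mult)
  qed
  have "(\<lambda>s. (s + 1) ^ N / sqrt (s + 2) * (1 + s) powr (- 1 / 2 - real j)) has_fps_expansion b_fps N * c_fps j"
    by (intro has_fps_expansion_mult has_fps_expansion_b_fps has_fps_expansion_c_fps)
  then have 3: "(\<lambda>s. ?\<phi> (1 + s) / sqrt (2 + s)) has_fps_expansion b_fps N * c_fps j"
    by (simp add: add.commute)
  from watson_cosh[OF 1 2 3] show ?thesis using that by blast
qed

text \<open>
  Insert the expansion of \<open>K\<^sub>\<nu>\<close> at \<open>w = x cosh t\<close> into the outer integral. As \<open>w \<ge> x\<close>, its error contributes
  \<open>O(x\<^bsup>-S\<^esup>)\<close>. The term with index \<open>j\<close> carries a factor \<open>x\<^bsup>-j\<^esup>\<close>, so its outer integral is expanded only up to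
  order \<open>S - j\<close>; in this way the double sum runs exactly over \<open>j + r < S\<close> and can be regrouped by \<open>j + r\<close>.
\<close>

lemma F_real_asymptotics:
  obtains C where "\<And>x. x \<ge> 1 \<Longrightarrow>
    \<bar>x * exp x * F_real N \<nu> x - (\<Sum>s<S. F_coeff N \<nu> s / x ^ s)\<bar> \<le> C / x ^ S"
proof -
  define k where "k = (\<lambda>w. LBINT u. cosh (real \<nu> * u) * exp (- w * cosh u))"
  define E where "E = (\<lambda>w. sqrt w * exp w * k w - (\<Sum>j<S. 2 * a_real (real \<nu>) j / w ^ j))"
  define I where "I = (\<lambda>j x. sqrt x * exp x * (LBINT t. cosh t ^ N * cosh t powr (- 1 / 2 - real j) * exp (- x * cosh t)))"
  define T where "T = (\<lambda>j x. \<Sum>r<S - j. 2 * Gamma (real r + 1 / 2) * fps_nth (b_fps N * c_fps j) r / x ^ r)"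
  obtain C where C: "\<And>w. w \<ge> 1 \<Longrightarrow> \<bar>E w\<bar> \<le> C / w ^ S"
    using bessel_asymptotics[of \<nu> S] unfolding E_def k_def by blast
  have C0: "C \<ge> 0" using order_trans[OF abs_ge_zero C[of 1]] by simp
  have "\<forall>j. \<exists>D. \<forall>x\<ge>1. \<bar>I j x - T j x\<bar> \<le> D / x ^ (S - j)"
  proof
    fix j
    obtain D where "\<And>x. x \<ge> 1 \<Longrightarrow> \<bar>I j x - T j x\<bar> \<le> D / x ^ (S - j)"
      using cosh_power_asymptotics[of N j "S - j"] unfolding I_def T_def by blast
    then show "\<exists>D. \<forall>x\<ge>1. \<bar>I j x - T j x\<bar> \<le> D / x ^ (S - j)" by blast
  qed
  from choice[OF this] obtain D where D: "\<And>j x. x \<ge> 1 \<Longrightarrow> \<bar>I j x - T j x\<bar> \<le> D j / x ^ (S - j)"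
    by blast
  \<comment> \<open>The outer integral for \<open>j = 0\<close> also bounds the contribution of the error term \<open>E\<close>.\<close>
  obtain B where B: "\<And>x. x \<ge> 1 \<Longrightarrow> \<bar>I 0 x\<bar> \<le> B"
    using cosh_power_asymptotics[of N 0 0] unfolding I_def by auto
  show ?thesis
  proof (rule that)
    fix x :: real assume x1: "x \<ge> 1"
    then have x: "x > 0" by simp
    have xc: "x * cosh t \<ge> 1" "x * cosh t > 0" for t
      using mult_mono[OF x1 cosh_real_ge_1[of t]] x by auto
    let ?h = "\<lambda>j t. cosh t ^ N * cosh t powr (- 1 / 2 - real j) * exp (- x * cosh t)"
    let ?Q = "(\<Sum>j<S. \<bar>2 * a_real (real \<nu>) j\<bar> * D j) + C * B"
    let ?rem = "\<lambda>t. ?h 0 t * E (x * cosh t)"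
    \<comment> \<open>With \<open>w = x cosh t\<close>, each power \<open>w\<^bsup>-j\<^esup>\<close> separates into \<open>x\<^bsup>-j\<^esup> cosh\<^bsup>-j\<^esup> t\<close>.\<close>
    have split: "sqrt x * (cosh t ^ N * k (x * cosh t)) = (\<Sum>j<S. 2 * a_real (real \<nu>) j / x ^ j * ?h j t) + ?rem t" for t
    proof -
      have pj: "cosh t powr (- 1 / 2 - real j) = cosh t powr (- 1 / 2) / cosh t ^ j" for j
        by (simp add: powr_diff powr_realpow)
      have p0: "sqrt (x * cosh t) * cosh t powr (- 1 / 2) = sqrt x"
        by (simp add: real_sqrt_mult powr_minus powr_half_sqrt[symmetric] powr_add[symmetric])
      have "(\<Sum>j<S. 2 * a_real (real \<nu>) j / x ^ j * ?h j t) + ?rem t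
          = cosh t ^ N * cosh t powr (- 1 / 2) * exp (- x * cosh t) *
             ((\<Sum>j<S. 2 * a_real (real \<nu>) j / (x * cosh t) ^ j) + E (x * cosh t))"
        unfolding distrib_left sum_distrib_left
        by (intro arg_cong2[where f = "(+)"] sum.cong refl; unfold pj) (simp_all add: power_mult_distrib)
      also have "\<dots> = cosh t ^ N * (sqrt (x * cosh t) * cosh t powr (- 1 / 2)) * (exp (- x * cosh t) * exp (x * cosh t)) * k (x * cosh t)"
        unfolding E_def by simp
      also have "exp (- x * cosh t) * exp (x * cosh t) = 1" by (simp add: mult_exp_exp)
      finally show ?thesis unfolding p0 by simp
    qed
    have dech: "cosh_decaying x (?h j)" for j
    proof (rule cosh_decayingI[where C = 1 and m = N])
      fix t :: real
      have "cosh t powr (- 1 / 2 - real j) \<le> cosh t powr 0"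
        using cosh_real_ge_1[of t] by (intro powr_mono) auto
      then have "cosh t powr (- 1 / 2 - real j) \<le> 1" by simp
      then show "norm (?h j t) \<le> 1 * (cosh t ^ N * exp (- x * cosh t))"
        by (simp add: abs_mult mult_ac mult_left_le_one_le)
    qed
    have inth: "integrable lborel (?h j)" for j
      by (rule integrable_cosh_decaying[OF dech x]) measurable
    have rem_le: "\<bar>?rem t\<bar> \<le> C / x ^ S * ?h 0 t" for t
    proof -
      have "\<bar>E (x * cosh t)\<bar> \<le> C / (x * cosh t) ^ S" by (rule C[OF xc(1)])
      also have "\<dots> \<le> C / x ^ S"
        using C0 x cosh_real_ge_1[of t]
        by (intro divide_left_mono power_mono mult_pos_pos zero_less_power) (auto simp: mult_le_cancel_left1)
      finally have "?h 0 t * \<bar>E (x * cosh t)\<bar> \<le> ?h 0 t * (C / x ^ S)"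
        by (intro mult_left_mono) auto
      then show ?thesis by (simp add: abs_mult mult_ac)
    qed
    have [measurable]: "(\<lambda>t. k (x * cosh t)) \<in> borel_measurable borel"
      unfolding k_def by measurable
    have intrem: "integrable lborel ?rem"
      by (rule Bochner_Integration.integrable_bound[OF integrable_mult_right[OF inth[of 0], of "C / x ^ S"]])
         (use rem_le order_trans[OF _ abs_ge_self] in \<open>auto simp: E_def simp del: times_divide_eq_left\<close>)
    have "sqrt x * (LBINT t. cosh t ^ N * k (x * cosh t)) = (LBINT t. (\<Sum>j<S. 2 * a_real (real \<nu>) j / x ^ j * ?h j t) + ?rem t)"
      unfolding split[symmetric] by simp
    also have "\<dots> = (\<Sum>j<S. 2 * a_real (real \<nu>) j / x ^ j * (LBINT t. ?h j t)) + (LBINT t. ?rem t)"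
      using inth intrem by (subst Bochner_Integration.integral_add) (auto simp: Bochner_Integration.integral_sum)
    finally have main: "4 * (x * exp x * F_real N \<nu> x)
        = (\<Sum>j<S. 2 * a_real (real \<nu>) j / x ^ j * I j x) + sqrt x * exp x * (LBINT t. ?rem t)"
    proof -
      assume eq: "sqrt x * (LBINT t. cosh t ^ N * k (x * cosh t))
        = (\<Sum>j<S. 2 * a_real (real \<nu>) j / x ^ j * (LBINT t. ?h j t)) + (LBINT t. ?rem t)"
      have "4 * (x * exp x * F_real N \<nu> x) = sqrt x * exp x * (sqrt x * (LBINT t. cosh t ^ N * k (x * cosh t)))"
        using x by (simp add: F_real_def k_def)
      also have "\<dots> = (\<Sum>j<S. 2 * a_real (real \<nu>) j / x ^ j * I j x) + sqrt x * exp x * (LBINT t. ?rem t)"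
        unfolding eq I_def distrib_left sum_distrib_left by (simp add: mult_ac)
      finally show ?thesis .
    qed
    have "\<bar>LBINT t. ?rem t\<bar> \<le> (LBINT t. \<bar>?rem t\<bar>)" by (rule integral_abs_bound)
    also have "\<dots> \<le> (LBINT t. C / x ^ S * ?h 0 t)"
      using rem_le intrem inth[of 0] by (intro integral_mono) auto
    also have "\<dots> = C / x ^ S * (LBINT t. ?h 0 t)" by simp
    finally have "sqrt x * exp x * \<bar>LBINT t. ?rem t\<bar> \<le> sqrt x * exp x * (C / x ^ S * (LBINT t. ?h 0 t))"
      using x by (intro mult_left_mono) auto
    also have "\<dots> = C / x ^ S * I 0 x" by (simp add: I_def)
    also have "\<dots> \<le> C / x ^ S * B"
      using B[OF x1] C0 x by (intro mult_left_mono) auto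
    finally have rem: "\<bar>sqrt x * exp x * (LBINT t. ?rem t)\<bar> \<le> C * B / x ^ S"
      using x by (simp add: abs_mult)
    have tri: "4 * (\<Sum>s<S. F_coeff N \<nu> s / x ^ s) = (\<Sum>j<S. 2 * a_real (real \<nu>) j / x ^ j * T j x)"
    proof -
      let ?g = "\<lambda>j r. 4 * (a_real (real \<nu>) j * Gamma (real r + 1 / 2) * fps_nth (b_fps N * c_fps j) r / x ^ (j + r))"
      have "4 * (\<Sum>s<S. F_coeff N \<nu> s / x ^ s) = (\<Sum>s<S. \<Sum>j\<le>s. ?g j (s - j))"
        unfolding F_coeff_def sum_distrib_left sum_divide_distrib by (intro sum.cong refl) auto
      also have "\<dots> = (\<Sum>(j, r)\<in>{(j, r). j + r < S}. ?g j r)"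
        by (rule sum.triangle_reindex[symmetric])
      also have "{(j, r). j + r < S} = (SIGMA j:{..<S}. {..<S - j})" by auto
      also have "(\<Sum>(j, r)\<in>(SIGMA j:{..<S}. {..<S - j}). ?g j r) = (\<Sum>j<S. \<Sum>r<S - j. ?g j r)"
        by (rule sum.Sigma[symmetric]) auto
      also have "\<dots> = (\<Sum>j<S. 2 * a_real (real \<nu>) j / x ^ j * T j x)"
        unfolding T_def sum_distrib_left by (intro sum.cong refl) (simp add: power_add)
      finally show ?thesis .
    qed
    have "\<bar>(\<Sum>j<S. 2 * a_real (real \<nu>) j / x ^ j * I j x) - (\<Sum>j<S. 2 * a_real (real \<nu>) j / x ^ j * T j x)\<bar>
        = \<bar>\<Sum>j<S. 2 * a_real (real \<nu>) j / x ^ j * (I j x - T j x)\<bar>"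
      by (simp only: sum_subtractf right_diff_distrib)
    also have "\<dots> \<le> (\<Sum>j<S. \<bar>2 * a_real (real \<nu>) j / x ^ j * (I j x - T j x)\<bar>)" by (rule sum_abs)
    also have "\<dots> \<le> (\<Sum>j<S. \<bar>2 * a_real (real \<nu>) j\<bar> * D j / x ^ S)"
    proof (rule sum_mono)
      fix j assume j: "j \<in> {..<S}"
      have "\<bar>2 * a_real (real \<nu>) j / x ^ j * (I j x - T j x)\<bar> = \<bar>2 * a_real (real \<nu>) j\<bar> / x ^ j * \<bar>I j x - T j x\<bar>"
        using x by (simp add: abs_mult)
      also have "\<dots> \<le> \<bar>2 * a_real (real \<nu>) j\<bar> / x ^ j * (D j / x ^ (S - j))"
        using D[OF x1] x by (intro mult_left_mono) auto
      also have "\<dots> = \<bar>2 * a_real (real \<nu>) j\<bar> * D j / x ^ S"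
        using j by (simp add: power_add[symmetric])
      finally show "\<bar>2 * a_real (real \<nu>) j / x ^ j * (I j x - T j x)\<bar> \<le> \<bar>2 * a_real (real \<nu>) j\<bar> * D j / x ^ S" .
    qed
    also have "\<dots> = (\<Sum>j<S. \<bar>2 * a_real (real \<nu>) j\<bar> * D j) / x ^ S"
      by (simp add: sum_divide_distrib)
    finally have IT: "\<bar>(\<Sum>j<S. 2 * a_real (real \<nu>) j / x ^ j * I j x) - (\<Sum>j<S. 2 * a_real (real \<nu>) j / x ^ j * T j x)\<bar>
        \<le> (\<Sum>j<S. \<bar>2 * a_real (real \<nu>) j\<bar> * D j) / x ^ S" .
    have "4 * \<bar>p - q\<bar> \<le> d + e" if "\<bar>i - t\<bar> \<le> d" "\<bar>r\<bar> \<le> e" "4 * p = i + r" "4 * q = t" for p q d e i t r :: real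
      using that by (smt (verit))
    from this[OF IT rem main tri] have "4 * \<bar>x * exp x * F_real N \<nu> x - (\<Sum>s<S. F_coeff N \<nu> s / x ^ s)\<bar>
        \<le> ?Q / x ^ S"
      unfolding add_divide_distrib .
    moreover have "a \<le> q / 4 / y" if "4 * a \<le> q / y" for a q y :: real
      using divide_right_mono[OF that, of 4] by simp
    ultimately show "\<bar>x * exp x * F_real N \<nu> x - (\<Sum>s<S. F_coeff N \<nu> s / x ^ s)\<bar> \<le> ?Q / 4 / x ^ S"
      by blast
  qed
qed

text \<open>
  Let \<open>w\<close> tend to 0 to see that the constant coefficient vanishes, divide by \<open>w\<close>, and repeat.
\<close>

lemma poly_coeff_eq_0_of_bound:
  fixes q :: "complex poly"
  assumes "\<And>w. 0 < w \<Longrightarrow> w \<le> 1 \<Longrightarrow> norm (poly q (of_real w)) \<le> C * w ^ S" and "s < S"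
  shows "coeff q s = 0"
  using assms
proof (induction S arbitrary: q s)
  case (Suc S)
  obtain c q' where q: "q = pCons c q'" by (cases q)
  have "((\<lambda>w. poly q (complex_of_real w)) \<longlongrightarrow> poly q (of_real 0)) (at_right 0)"
    by (intro tendsto_intros)
  moreover have "((\<lambda>w. poly q (complex_of_real w)) \<longlongrightarrow> 0) (at_right 0)"
  proof (rule Lim_null_comparison)
    show "\<forall>\<^sub>F w in at_right 0. norm (poly q (complex_of_real w)) \<le> C * w ^ Suc S"
      unfolding eventually_at_right_field using Suc.prems(1)
      by (intro exI[of _ 1] conjI allI impI) (auto simp del: power_Suc)
    show "((\<lambda>w::real. C * w ^ Suc S) \<longlongrightarrow> 0) (at_right 0)"
      by (auto intro!: tendsto_eq_intros)
  qed
  ultimately have "poly q (of_real 0) = 0"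
    by (rule tendsto_unique[OF trivial_limit_at_right_real])
  then have c: "c = 0" by (simp add: q)
  have "norm (poly q' (of_real w)) \<le> C * w ^ S" if "0 < w" "w \<le> 1" for w
    using Suc.prems(1)[OF that] that by (simp add: q c norm_mult mult_ac)
  then show ?case using Suc.IH[of q'] Suc.prems(2) by (cases s) (auto simp: q c)
qed simp

text \<open>
  The identification holds for every index, including those above \<open>M_index N \<nu>\<close>, where both sides are 0.
  This is what allows the expansions for \<open>N\<close> and \<open>N + 2\<close> to be subtracted although their lengths differ.
\<close>

lemma coeff_F_poly:
  assumes parity: "odd (N + \<nu>)"
  shows "coeff (F_poly N \<nu>) s = of_real (F_coeff N \<nu> s)"
proof -
  let ?S = "Suc s"
  let ?A = "\<Sum>i<?S. monom (complex_of_real (F_coeff N \<nu> i)) i"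
  obtain C where C: "\<And>x. x \<ge> 1 \<Longrightarrow>
    \<bar>x * exp x * F_real N \<nu> x - (\<Sum>i<?S. F_coeff N \<nu> i / x ^ i)\<bar> \<le> C / x ^ ?S"
    using F_real_asymptotics[of N \<nu> ?S] by blast
  have "norm (poly (F_poly N \<nu> - ?A) (of_real w)) \<le> C * w ^ ?S" if w: "0 < w" "w \<le> 1" for w
  proof -
    define x where "x = 1 / w"
    have x: "x \<ge> 1" "x > 0" using w by (auto simp: x_def)
    have wx: "of_real w = 1 / complex_of_real x" by (simp add: x_def)
    have "of_real (F_real N \<nu> x) = exp (- of_real x) / of_real x * poly (F_poly N \<nu>) (1 / of_real x)"
      using F_int_eq_poly[OF parity, of "of_real x"] F_int_of_real[OF x(2)] x by simp
    then have "poly (F_poly N \<nu>) (1 / of_real x) = of_real (x * exp x * F_real N \<nu> x)"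
      using x by (simp add: exp_minus field_simps flip: exp_of_real)
    then have "poly (F_poly N \<nu> - ?A) (of_real w) = of_real (x * exp x * F_real N \<nu> x - (\<Sum>i<?S. F_coeff N \<nu> i / x ^ i))"
      unfolding wx by (simp add: poly_sum poly_monom power_divide)
    then have "norm (poly (F_poly N \<nu> - ?A) (of_real w)) \<le> C / x ^ ?S"
      using C[OF x(1)] by (simp only: norm_of_real)
    then show ?thesis by (simp add: x_def power_divide)
  qed
  from poly_coeff_eq_0_of_bound[OF this, of s] show ?thesis
    by (simp add: coeff_sum if_distrib cong: if_cong)
qed

lemma sum_antidiagonal: "(\<Sum>(j, r)\<in>{(j, r). j + r = s}. g j r) = (\<Sum>j\<le>(s::nat). g j (s - j))"
  by (rule sum.reindex_bij_witness[of _ "\<lambda>j. (j, s - j)" fst]) auto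

lemma F_coeff_eq:
  "complex_of_real (F_coeff N \<nu> s) = (\<Sum>(j, r)\<in>{(j, r). j + r = s}.
      a_coeff (of_nat \<nu>) j * complex_of_real (Gamma (real r + 1 / 2)) *
      (\<Sum>(k, l)\<in>{(k, l). k + l = r}. complex_of_real (b_coeff k N * c_coeff l j)))"
  unfolding sum_antidiagonal F_coeff_def
  by (simp add: a_coeff_eq_a_real fps_mult_nth b_fps_def c_fps_def atLeast0AtMost)

definition G_coeff :: "nat \<Rightarrow> nat \<Rightarrow> nat \<Rightarrow> real" where
  "G_coeff N \<nu> s = (\<Sum>j\<le>s. a_real (real \<nu>) j * Gamma (real (s - j) + 3 / 2) * fps_nth (d_fps N * c_fps j) (s - j))"

lemma G_coeff_eq:
  "complex_of_real (G_coeff N \<nu> s) = (\<Sum>(j, r)\<in>{(j, r). j + r = s}.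
      a_coeff (of_nat \<nu>) j * complex_of_real (Gamma (real r + 3 / 2)) *
      (\<Sum>(k, l)\<in>{(k, l). k + l = r}. complex_of_real (d_coeff k N * c_coeff l j)))"
  unfolding sum_antidiagonal G_coeff_def
  by (simp add: a_coeff_eq_a_real fps_mult_nth d_fps_def c_fps_def atLeast0AtMost)

text \<open>
  Multiplication of a series by the variable moves its coefficients up by one, so the index \<open>r\<close> of
  the \<open>F\<close>-coefficients corresponds to \<open>r - 1\<close> in the \<open>G\<close>-coefficients, and \<open>\<Gamma>(r + 1/2)\<close> becomes
  \<open>\<Gamma>((r - 1) + 3/2)\<close>.
\<close>

lemma F_coeff_diff:
  "F_coeff (N + 2) \<nu> 0 - F_coeff N \<nu> 0 = 0"
  "F_coeff (N + 2) \<nu> (Suc s) - F_coeff N \<nu> (Suc s) = G_coeff N \<nu> s"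
proof -
  have eq: "F_coeff (N + 2) \<nu> s - F_coeff N \<nu> s
      = (\<Sum>j\<le>s. a_real (real \<nu>) j * Gamma (real (s - j) + 1 / 2) * fps_nth (fps_X * (d_fps N * c_fps j)) (s - j))" for s
    unfolding mult.assoc[symmetric, of fps_X] b_fps_diff[symmetric] F_coeff_def
    by (simp add: sum_subtractf[symmetric] algebra_simps)
  show "F_coeff (N + 2) \<nu> 0 - F_coeff N \<nu> 0 = 0" unfolding eq by simp
  have "a_real (real \<nu>) j * Gamma (real (Suc s - j) + 1 / 2) * fps_nth (fps_X * (d_fps N * c_fps j)) (Suc s - j)
      = a_real (real \<nu>) j * Gamma (real (s - j) + 3 / 2) * fps_nth (d_fps N * c_fps j) (s - j)" if "j \<le> s" for j
    using that by (simp add: Suc_diff_le add_ac)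
  then have "(\<Sum>j\<le>s. a_real (real \<nu>) j * Gamma (real (Suc s - j) + 1 / 2) * fps_nth (fps_X * (d_fps N * c_fps j)) (Suc s - j))
      = G_coeff N \<nu> s"
    unfolding G_coeff_def by (intro sum.cong refl) (simp only: atMost_iff)
  then show "F_coeff (N + 2) \<nu> (Suc s) - F_coeff N \<nu> (Suc s) = G_coeff N \<nu> s"
    unfolding eq sum.atMost_Suc by simp
qed

theorem theorem1p2:
  fixes N \<nu> :: nat and z :: complex
  assumes parity: "(even N \<and> odd \<nu>) \<or> (odd N \<and> even \<nu>)"
    and z: "Re z > 0"
  shows "F_int N (of_nat \<nu>) z =
      z powi (- 1) * exp (- z) *
        (\<Sum>s=0..M_index N \<nu>.
           (\<Sum>(j, r)\<in>{(j, r). j + r = s}.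
              a_coeff (of_nat \<nu>) j * complex_of_real (Gamma (real r + 1 / 2)) *
              (\<Sum>(k, l)\<in>{(k, l). k + l = r}. complex_of_real (b_coeff k N * c_coeff l j)))
           * z powi (- int s))
    \<and> G_int N (of_nat \<nu>) z =
      z powi (- 2) * exp (- z) *
        (\<Sum>s=0..K_index N \<nu>.
           (\<Sum>(j, r)\<in>{(j, r). j + r = s}.
              a_coeff (of_nat \<nu>) j * complex_of_real (Gamma (real r + 3 / 2)) *
              (\<Sum>(k, l)\<in>{(k, l). k + l = r}. complex_of_real (d_coeff k N * c_coeff l j)))
           * z powi (- int s))"
proof -
  have odd: "odd (N + \<nu>)" "odd (N + 2 + \<nu>)" using parity by auto
  have z0: "z \<noteq> 0" using z by auto
  have powi: "z powi (- int s) = (1 / z) ^ s" for s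
    by (simp add: power_int_minus power_one_over inverse_eq_divide)
  have expand: "poly p (1 / z) = (\<Sum>s\<le>n. coeff p s * z powi (- int s))" if "degree p \<le> n" for p :: "complex poly" and n
    unfolding powi poly_altdef
    by (rule sum.mono_neutral_left) (use that in \<open>auto simp: coeff_eq_0\<close>)
  have F: "F_int N (of_nat \<nu>) z = z powi (- 1) * exp (- z) *
      (\<Sum>s=0..M_index N \<nu>. of_real (F_coeff N \<nu> s) * z powi (- int s))"
    unfolding F_int_eq_poly[OF odd(1) z] expand[OF degree_F_poly[OF odd(1)]] coeff_F_poly[OF odd(1)] atLeast0AtMost
    by (simp add: power_int_minus divide_inverse)
  define M where "M = K_index N \<nu>"
  have M: "M_index (N + 2) \<nu> = Suc M" "M_index N \<nu> \<le> Suc M"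
    using parity unfolding M_def K_index_def M_index_def by (auto elim!: oddE evenE)
  have "G_int N (of_nat \<nu>) z = exp (- z) / z * poly (F_poly (N + 2) \<nu> - F_poly N \<nu>) (1 / z)"
    unfolding G_int_eq_F_int[OF z] F_int_eq_poly[OF odd(1) z] F_int_eq_poly[OF odd(2) z]
    by (simp add: algebra_simps)
  also have "degree (F_poly (N + 2) \<nu> - F_poly N \<nu>) \<le> Suc M"
    using degree_F_poly[OF odd(1)] degree_F_poly[OF odd(2)] M by (intro degree_diff_le) auto
  then have "poly (F_poly (N + 2) \<nu> - F_poly N \<nu>) (1 / z)
      = (\<Sum>s\<le>Suc M. complex_of_real (F_coeff (N + 2) \<nu> s - F_coeff N \<nu> s) * z powi (- int s))"
    by (simp only: expand coeff_diff coeff_F_poly[OF odd(1)] coeff_F_poly[OF odd(2)] of_real_diff)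
  also have "\<dots> = (\<Sum>s\<le>M. complex_of_real (G_coeff N \<nu> s) * z powi (- int (Suc s)))"
    unfolding sum.atMost_Suc_shift F_coeff_diff by simp
  also have "\<dots> = 1 / z * (\<Sum>s\<le>M. complex_of_real (G_coeff N \<nu> s) * z powi (- int s))"
    unfolding powi sum_distrib_left by (intro sum.cong refl) simp
  finally have G: "G_int N (of_nat \<nu>) z = z powi (- 2) * exp (- z) *
      (\<Sum>s=0..K_index N \<nu>. of_real (G_coeff N \<nu> s) * z powi (- int s))"
    unfolding M_def atLeast0AtMost by (simp add: power_int_minus power2_eq_square divide_inverse mult_ac)
  show ?thesis using F G unfolding F_coeff_eq G_coeff_eq by blast
qed

end
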